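(* Assume the setting below. Let $\chi_0\ge(|L|+2)^{<\kappa}$ be a cardinal such that $\mathcal N$ does not have the order property of length $\chi_0^+$, and let $\chi:=\left(2^{2^{\chi_0}}\right)^+$. If $\mathbf I$ is a $(\chi_0^+,\chi_0^+,\chi)$-Morley sequence, then $\mathbf I$ is $\chi$-convergent.
   Context: Setting: $\kappa$ is an infinite cardinal, $L$ a $(<\kappa)$-ary language, $\mathcal N$ a fixed $L$-structure, and we work inside $\mathcal N$. All formulas are quantifier-free $L_{\kappa,\kappa}$-formulas; $\mathrm{tp}(\bar c/A)$ is the quantifier-free $L_{\kappa,\kappa}$-type of $\bar c$ over $A$ in $\mathcal N$; $S^\alpha(A)$ is the set of complete such types of length $\alpha$ over $A$ realized in $\mathcal N$; tuples $\bar a,\bar b,\bar c$ have length $<\kappa$. A fixed family $\mathcal S\subseteq\mathcal P(|\mathcal N|)$ is closed under unions of increasing chains and satisfies: if $A\subseteq B$ and $A\in\mathcal S$, there is $A'\in\mathcal S$ with $A\subseteq A'\subseteq B$ and $|A'|\le(|L|+2)^{<\kappa}+|A|$; members of $\mathcal S$ are called models. A model $M$ is $\lambda$-saturated for types of length $\alpha$ if for every $A\subseteq|M|$ with $|A|<\lambda$ every $p\in S^\alpha(A)$ is realized in $M$; $M$ is $\lambda$-saturated if this holds for all lengths $<\kappa$. Standing assumption: if $\mu>(|L|+2)^{<\kappa}$, every model that is $\mu$-saturated for types of length one is $\mu$-saturated. $\mathcal N$ has the order property of length $\chi$ if there are a formula $\phi(\bar x,\bar y)$ and tuples $\langle\bar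 a_i:i<\chi\rangle$ with $\models\phi[\bar a_i,\bar a_j]$ iff $i<j$. A sequence $\mathbf I=\langle\bar a_i:i\in I\rangle$ ($I$ a linear order) consists of tuples of the same length $<\kappa$; $|\mathbf I|$ is the number of distinct entries. $\mathrm{Av}_\chi(\mathbf I/A)$ is the set of formulas $\phi(\bar x)$ over $A$ such that $|\{\bar b\in\mathbf I:\models\neg\phi[\bar b]\}|<\chi$. $\mathbf I$ is $\chi$-convergent if $|\mathbf I|\ge\chi$ and $\mathrm{Av}_\chi(\mathbf I/A)$ is a complete type over $A$ for every $A$. A set of formulas $p$ splits over $A$ if there are $\phi(\bar x,\bar b)\in p$ and $\bar b'$ with $\mathrm{tp}(\bar b'/A)=\mathrm{tp}(\bar b/A)$ and $\neg\phi(\bar x,\bar b')\in p$. For infinite cardinals $\chi_0'\le\chi_1\le\chi_2$, $\langle\bar a_i:i\in I\rangle$ is $(\chi_0',\chi_1,\chi_2)$-Morley (for some set of formulas $p(\bar x)$ over some set $A$) if there are models $\langle N_i:i\in I\rangle$ and $\alpha<\kappa$ with: each $\bar a_i\in{}^\alpha|\mathcal N|$; $A\subseteq|N_i|$ and $|A|<\chi_0'$; $\langle N_i\rangle$ increasing and each $N_i$ $\chi_1$-saturated; $\bar a_i$ realizes $p\restriction N_i$ and $\bar a_i\in{}^\alpha|N_j|$ for $j>i$; $\bar a_i\ne\bar a_j$ for $i<j$; $|I|\ge\chi_2$; $\mathrm{tp}(\bar a_i/N_i)=\mathrm{tp}(\bar a_j/N_i)$ for $i<j$; and $\mathrm{tp}(\bar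 a_i/N_i)$ does not split over $A$. *)

theory Defs
  imports Main
begin

unbundle cardinal_syntax

text \<open>
  Cardinals are the relations of HOL's cardinal library.  For a cardinal \<open>\<kappa>\<close>, the ordinals below
  \<open>\<kappa>\<close> are represented by the elements of \<open>Field \<kappa>\<close>: the element \<open>\<alpha>\<close> stands for the order type of
  \<open>underS \<kappa> \<alpha>\<close>, and every ordinal \<open>< \<kappa>\<close> arises exactly once.  A sequence of length \<open>\<alpha>\<close> is a partial
  map with domain \<open>underS \<kappa> \<alpha>\<close>.
\<close>

definition tuples :: "'k rel \<Rightarrow> 'k \<Rightarrow> 'b set \<Rightarrow> ('k \<rightharpoonup> 'b) set" where
  "tuples \<kappa> \<alpha> A = {c. dom c = underS \<kappa> \<alpha> \<and> ran c \<subseteq> A}"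

text \<open>
  \<open>cexp_less r \<kappa>\<close> is \<open>r\<^sup><\<^sup>\<kappa>\<close>, the number of sequences of length \<open>< \<kappa>\<close> from a set of size \<open>r\<close>.  For
  infinite \<open>\<kappa>\<close> and \<open>r \<ge> 2\<close> this is the supremum of the powers \<open>r\<^sup>\<lambda>\<close> with \<open>\<lambda> < \<kappa>\<close>; see
  \<open>cexp_less_upper\<close> and \<open>cexp_less_least\<close> below.
\<close>

definition cexp_less :: "'b rel \<Rightarrow> 'k rel \<Rightarrow> ('k \<rightharpoonup> 'b) rel" where
  "cexp_less r \<kappa> = |\<Union>\<alpha>\<in>Field \<kappa>. tuples \<kappa> \<alpha> (Field r)|"

lemma card_of_tuples: "|tuples \<kappa> \<alpha> (Field r)| =o r ^c |underS \<kappa> \<alpha>|"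
proof -
  let ?U = "underS \<kappa> \<alpha>"
  have "bij_betw (\<lambda>c i. if i \<in> ?U then the (c i) else undefined)
      (tuples \<kappa> \<alpha> (Field r)) (Func ?U (Field r))"
  proof (rule bij_betw_byWitness[where f' = "\<lambda>f i. if i \<in> ?U then Some (f i) else None"])
    show "\<forall>c\<in>tuples \<kappa> \<alpha> (Field r).
        (\<lambda>i. if i \<in> ?U then Some (if i \<in> ?U then the (c i) else undefined) else None) = c"
    proof (intro ballI ext)
      fix c i assume "c \<in> tuples \<kappa> \<alpha> (Field r)"
      then have "i \<in> ?U \<longleftrightarrow> c i \<noteq> None"
        by (auto simp: tuples_def)
      then show "(if i \<in> ?U then Some (if i \<in> ?U then the (c i) else undefined) else None) = c i"
        by auto
    qed
    show "\<forall>f\<in>Func ?U (Field r).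
        (\<lambda>i. if i \<in> ?U then the (if i \<in> ?U then Some (f i) else None) else undefined) = f"
      by (auto simp: Func_def fun_eq_iff)
    show "(\<lambda>c i. if i \<in> ?U then the (c i) else undefined) ` tuples \<kappa> \<alpha> (Field r) \<subseteq> Func ?U (Field r)"
    proof -
      have "the (c i) \<in> Field r" if "c \<in> tuples \<kappa> \<alpha> (Field r)" "i \<in> ?U" for c i
      proof -
        from that obtain x where "c i = Some x" unfolding tuples_def by blast
        then show ?thesis using that(1) unfolding tuples_def by (auto dest: ranI)
      qed
      then show ?thesis by (auto simp: Func_def)
    qed
    show "(\<lambda>f i. if i \<in> ?U then Some (f i) else None) ` Func ?U (Field r) \<subseteq> tuples \<kappa> \<alpha> (Field r)"
      by (auto simp: tuples_def Func_def ran_def dom_def split: if_splits)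
  qed
  then show ?thesis
    unfolding cexp_def Field_card_of by (rule card_of_ordIsoI)
qed

lemma cexp_less_upper:
  assumes "\<alpha> \<in> Field \<kappa>"
  shows "r ^c |underS \<kappa> \<alpha>| \<le>o cexp_less r \<kappa>"
proof -
  have "|tuples \<kappa> \<alpha> (Field r)| \<le>o cexp_less r \<kappa>"
    using assms by (auto simp: cexp_less_def intro!: card_of_mono1)
  then show ?thesis
    by (rule ordIso_ordLeq_trans[OF ordIso_symmetric[OF card_of_tuples]])
qed

lemma cexp_less_least:
  assumes "Cinfinite \<kappa>" and "ctwo \<le>o r" and "Card_order s"
    and "\<And>\<alpha>. \<alpha> \<in> Field \<kappa> \<Longrightarrow> r ^c |underS \<kappa> \<alpha>| \<le>o s"
  shows "cexp_less r \<kappa> \<le>o s"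
proof -
  have \<kappa>: "Card_order \<kappa>" "Well_order \<kappa>" and s: "Well_order s"
    using assms(1,3) by (auto simp: card_order_on_well_order_on)
  have "\<kappa> \<le>o s"
  proof (rule ccontr)
    assume "\<not> \<kappa> \<le>o s"
    then have "s <o \<kappa>"
      using \<kappa> s not_ordLeq_iff_ordLess by blast
    then obtain \<alpha> where \<alpha>: "\<alpha> \<in> Field \<kappa>" "s =o Restr \<kappa> (underS \<kappa> \<alpha>)"
      using \<kappa> s ordLess_iff_ordIso_Restr by blast
    have "Field (Restr \<kappa> (underS \<kappa> \<alpha>)) = underS \<kappa> \<alpha>"
      using \<kappa>(2) by (intro Refl_Field_Restr2)
        (auto simp: order_on_defs well_order_on_def underS_def Field_def)
    then have "s =o |underS \<kappa> \<alpha>|"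
      using ordIso_transitive[OF ordIso_symmetric[OF card_of_Field_ordIso[OF assms(3)]]
          card_of_cong[OF \<alpha>(2)]]
      by simp
    then have "ctwo ^c s =o ctwo ^c |underS \<kappa> \<alpha>|"
      using assms(3) by (intro cexp_cong2) (auto simp: Card_order_ctwo)
    also have "ctwo ^c |underS \<kappa> \<alpha>| \<le>o r ^c |underS \<kappa> \<alpha>|"
      using assms(2) by (intro cexp_mono1) (auto simp: card_of_Card_order)
    also have "r ^c |underS \<kappa> \<alpha>| \<le>o s"
      by (rule assms(4)[OF \<alpha>(1)])
    finally have "ctwo ^c s \<le>o s" .
    then show False
      using not_ordLess_ordLeq[OF ordLess_ctwo_cexp[OF assms(3)]] by contradiction
  qed
  then have "Cinfinite s" "|Field \<kappa>| \<le>o s"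
    using assms(1,3) cinfinite_mono ordIso_ordLeq_trans[OF card_of_Field_ordIso[OF \<kappa>(1)]] by auto
  moreover have "|tuples \<kappa> \<alpha> (Field r)| \<le>o s" if "\<alpha> \<in> Field \<kappa>" for \<alpha>
    by (rule ordIso_ordLeq_trans[OF card_of_tuples assms(4)[OF that]])
  ultimately show ?thesis
    unfolding cexp_less_def
    by (intro card_of_UNION_ordLeq_infinite_Field) (auto simp: cinfinite_def)
qed


record ('f, 'r, 'k) lang =
  fun_syms :: "'f set"
  rel_syms :: "'r set"
  fun_arity :: "'f \<Rightarrow> 'k"
  rel_arity :: "'r \<Rightarrow> 'k"

text \<open>The universe of a structure is the whole type \<open>'a\<close>.\<close>

record ('f, 'r, 'k, 'a) struct = "('f, 'r, 'k) lang" +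
  fun_interp :: "'f \<Rightarrow> ('k \<rightharpoonup> 'a) \<Rightarrow> 'a"
  rel_interp :: "'r \<Rightarrow> ('k \<rightharpoonup> 'a) \<Rightarrow> bool"

definition less_ary :: "'k rel \<Rightarrow> ('f, 'r, 'k, 'm) lang_scheme \<Rightarrow> bool" where
  "less_ary \<kappa> L \<longleftrightarrow>
     (\<forall>f\<in>fun_syms L. fun_arity L f \<in> Field \<kappa>) \<and> (\<forall>R\<in>rel_syms L. rel_arity L R \<in> Field \<kappa>)"

definition card_lang :: "('f, 'r, 'k, 'm) lang_scheme \<Rightarrow> ('f + 'r) rel" where
  "card_lang L = |fun_syms L| +c |rel_syms L|"

text \<open>\<open>(|L| + 2)\<^sup><\<^sup>\<kappa>\<close>\<close>

definition LS_card ::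
    "'k rel \<Rightarrow> ('f, 'r, 'k, 'm) lang_scheme \<Rightarrow> ('k \<rightharpoonup> ('f + 'r) + bool) rel" where
  "LS_card \<kappa> L = cexp_less (card_lang L +c ctwo) \<kappa>"


text \<open>
  Formulas \<open>\<phi>(x, y)\<close> come with two tuples of variables: \<open>VX i\<close> is the \<open>i\<close>-th entry of \<open>x\<close> and \<open>VY j\<close>
  the \<open>j\<close>-th entry of \<open>y\<close>.  Parameters are plugged in for \<open>y\<close>.
\<close>

datatype 'k var = VX 'k | VY 'k

datatype ('f, 'k) trm =
    Var "'k var"
  | Fun 'f "'k \<Rightarrow> ('f, 'k) trm option"

datatype ('f, 'r, 'k) fm =
    Eq "('f, 'k) trm" "('f, 'k) trm"
  | Rel 'r "'k \<Rightarrow> ('f, 'k) trm option"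
  | Neg "('f, 'r, 'k) fm"
  | Conj "'k \<Rightarrow> ('f, 'r, 'k) fm option"

inductive_set terms :: "'k rel \<Rightarrow> ('f, 'r, 'k, 'm) lang_scheme \<Rightarrow> 'k var set \<Rightarrow> ('f, 'k) trm set"
  for \<kappa> L V where
  "v \<in> V \<Longrightarrow> Var v \<in> terms \<kappa> L V"
| "\<lbrakk>f \<in> fun_syms L; dom ts = underS \<kappa> (fun_arity L f); \<forall>t\<in>ran ts. t \<in> terms \<kappa> L V\<rbrakk>
    \<Longrightarrow> Fun f ts \<in> terms \<kappa> L V"

text \<open>
  The quantifier-free formulas of \<open>L\<^sub>\<kappa>\<^sub>,\<^sub>\<kappa>\<close> with variables in \<open>V\<close>: closed under negation and under
  conjunctions of fewer than \<open>\<kappa>\<close> formulas.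
\<close>

inductive_set qf_fms ::
    "'k rel \<Rightarrow> ('f, 'r, 'k, 'm) lang_scheme \<Rightarrow> 'k var set \<Rightarrow> ('f, 'r, 'k) fm set"
  for \<kappa> L V where
  "\<lbrakk>s \<in> terms \<kappa> L V; t \<in> terms \<kappa> L V\<rbrakk> \<Longrightarrow> Eq s t \<in> qf_fms \<kappa> L V"
| "\<lbrakk>R \<in> rel_syms L; ts \<in> tuples \<kappa> (rel_arity L R) (terms \<kappa> L V)\<rbrakk> \<Longrightarrow> Rel R ts \<in> qf_fms \<kappa> L V"
| "\<phi> \<in> qf_fms \<kappa> L V \<Longrightarrow> Neg \<phi> \<in> qf_fms \<kappa> L V"
| "\<lbrakk>\<alpha> \<in> Field \<kappa>; dom \<Phi> = underS \<kappa> \<alpha>; \<forall>\<phi>\<in>ran \<Phi>. \<phi> \<in> qf_fms \<kappa> L V\<rbrakk>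
    \<Longrightarrow> Conj \<Phi> \<in> qf_fms \<kappa> L V"

primrec trm_val ::
    "('f, 'r, 'k, 'a, 'm) struct_scheme \<Rightarrow> ('k var \<Rightarrow> 'a) \<Rightarrow> ('f, 'k) trm \<Rightarrow> 'a" where
  "trm_val N e (Var v) = e v"
| "trm_val N e (Fun f ts) = fun_interp N f (\<lambda>i. map_option (trm_val N e) (ts i))"

primrec fm_val ::
    "('f, 'r, 'k, 'a, 'm) struct_scheme \<Rightarrow> ('k var \<Rightarrow> 'a) \<Rightarrow> ('f, 'r, 'k) fm \<Rightarrow> bool" where
  "fm_val N e (Eq s t) \<longleftrightarrow> trm_val N e s = trm_val N e t"
| "fm_val N e (Rel R ts) \<longleftrightarrow> rel_interp N R (\<lambda>i. map_option (trm_val N e) (ts i))"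
| "fm_val N e (Neg \<phi>) \<longleftrightarrow> \<not> fm_val N e \<phi>"
| "fm_val N e (Conj \<Phi>) \<longleftrightarrow> (\<forall>i. pred_option (fm_val N e) (\<Phi> i))"

definition vars :: "'k rel \<Rightarrow> 'k \<Rightarrow> 'k \<Rightarrow> 'k var set" where
  "vars \<kappa> \<alpha> \<beta> = VX ` underS \<kappa> \<alpha> \<union> VY ` underS \<kappa> \<beta>"

text \<open>\<open>sat N \<phi> c b\<close> is \<open>N \<Turnstile> \<phi>[c, b]\<close>.\<close>

definition sat ::
    "('f, 'r, 'k, 'a, 'm) struct_scheme \<Rightarrow> ('f, 'r, 'k) fm \<Rightarrow> ('k \<rightharpoonup> 'a) \<Rightarrow> ('k \<rightharpoonup> 'a) \<Rightarrow> bool" where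
  "sat N \<phi> c b \<longleftrightarrow> fm_val N (\<lambda>v. case v of VX i \<Rightarrow> the (c i) | VY j \<Rightarrow> the (b j)) \<phi>"


text \<open>A formula \<open>\<phi>(x, b)\<close> with parameters is the pair \<open>(\<phi>, b)\<close>.\<close>

type_synonym ('f, 'r, 'k, 'a) pfm = "('f, 'r, 'k) fm \<times> ('k \<rightharpoonup> 'a)"

definition fms_over ::
    "'k rel \<Rightarrow> ('f, 'r, 'k, 'a, 'm) struct_scheme \<Rightarrow> 'k \<Rightarrow> 'a set \<Rightarrow> ('f, 'r, 'k, 'a) pfm set" where
  "fms_over \<kappa> N \<alpha> A =
     {(\<phi>, b). \<exists>\<beta>\<in>Field \<kappa>. \<phi> \<in> qf_fms \<kappa> N (vars \<kappa> \<alpha> \<beta>) \<and> b \<in> tuples \<kappa> \<beta> A}"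

definition realizes ::
    "('f, 'r, 'k, 'a, 'm) struct_scheme \<Rightarrow> ('k \<rightharpoonup> 'a) \<Rightarrow> ('f, 'r, 'k, 'a) pfm set \<Rightarrow> bool" where
  "realizes N c p \<longleftrightarrow> (\<forall>(\<phi>, b)\<in>p. sat N \<phi> c b)"

text \<open>\<open>\<alpha>\<close> is the length of the tuple \<open>c\<close>.\<close>

definition tp ::
    "'k rel \<Rightarrow> ('f, 'r, 'k, 'a, 'm) struct_scheme \<Rightarrow> 'k \<Rightarrow> ('k \<rightharpoonup> 'a) \<Rightarrow> 'a set
      \<Rightarrow> ('f, 'r, 'k, 'a) pfm set" where
  "tp \<kappa> N \<alpha> c A = {(\<phi>, b) \<in> fms_over \<kappa> N \<alpha> A. sat N \<phi> c b}"

definition restrict_fms ::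
    "('f, 'r, 'k, 'a) pfm set \<Rightarrow> 'a set \<Rightarrow> ('f, 'r, 'k, 'a) pfm set" where
  "restrict_fms p A = {(\<phi>, b) \<in> p. ran b \<subseteq> A}"

definition realized_types ::
    "'k rel \<Rightarrow> ('f, 'r, 'k, 'a, 'm) struct_scheme \<Rightarrow> 'k \<Rightarrow> 'a set
      \<Rightarrow> ('f, 'r, 'k, 'a) pfm set set" where
  "realized_types \<kappa> N \<alpha> A = {tp \<kappa> N \<alpha> c A |c. c \<in> tuples \<kappa> \<alpha> UNIV}"

text \<open>
  Unlike \<open>realized_types\<close>, a complete type in this sense need not be realized; it decides every
  formula and is consistent in that each fewer than \<open>\<kappa>\<close> of its formulas are simultaneously satisfied
  in \<open>N\<close>.
\<close>

definition complete_type ::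
    "'k rel \<Rightarrow> ('f, 'r, 'k, 'a, 'm) struct_scheme \<Rightarrow> 'k \<Rightarrow> 'a set
      \<Rightarrow> ('f, 'r, 'k, 'a) pfm set \<Rightarrow> bool" where
  "complete_type \<kappa> N \<alpha> A p \<longleftrightarrow>
     p \<subseteq> fms_over \<kappa> N \<alpha> A \<and>
     (\<forall>q\<subseteq>p. |q| <o \<kappa> \<longrightarrow> (\<exists>c\<in>tuples \<kappa> \<alpha> UNIV. realizes N c q)) \<and>
     (\<forall>(\<phi>, b)\<in>fms_over \<kappa> N \<alpha> A. (\<phi>, b) \<in> p \<or> (Neg \<phi>, b) \<in> p)"

definition saturated_len ::
    "'k rel \<Rightarrow> ('f, 'r, 'k, 'a, 'm) struct_scheme \<Rightarrow> 'c rel \<Rightarrow> 'k \<Rightarrow> 'a set \<Rightarrow> bool" where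
  "saturated_len \<kappa> N \<mu> \<alpha> M \<longleftrightarrow>
     (\<forall>A\<subseteq>M. |A| <o \<mu> \<longrightarrow>
       (\<forall>p\<in>realized_types \<kappa> N \<alpha> A. \<exists>c\<in>tuples \<kappa> \<alpha> M. realizes N c p))"

definition saturated ::
    "'k rel \<Rightarrow> ('f, 'r, 'k, 'a, 'm) struct_scheme \<Rightarrow> 'c rel \<Rightarrow> 'a set \<Rightarrow> bool" where
  "saturated \<kappa> N \<mu> M \<longleftrightarrow> (\<forall>\<alpha>\<in>Field \<kappa>. saturated_len \<kappa> N \<mu> \<alpha> M)"

text \<open>
  The standing assumptions on the family \<open>S\<close> of models.  In the second one, \<open>B\<close> is not required to be
  in \<open>S\<close>.  In the last one, the type of \<open>\<mu>\<close> has room for a cardinal above both \<open>LS_card \<kappa> N\<close> and the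
  size of the universe; beyond that \<open>\<mu>\<close>-saturation no longer depends on \<open>\<mu>\<close>, so all cardinals are
  covered.  The length one is the \<open>\<alpha>\<close> with exactly one predecessor.
\<close>

definition model_family ::
    "'k rel \<Rightarrow> ('f, 'r, 'k, 'a, 'm) struct_scheme \<Rightarrow> 'a set set \<Rightarrow> bool" where
  "model_family \<kappa> N S \<longleftrightarrow>
     (\<forall>C. C \<noteq> {} \<and> subset.chain S C \<longrightarrow> \<Union>C \<in> S) \<and>
     (\<forall>A B. A \<subseteq> B \<and> A \<in> S \<longrightarrow>
        (\<exists>A'\<in>S. A \<subseteq> A' \<and> A' \<subseteq> B \<and> |A'| \<le>o LS_card \<kappa> N +c |A| )) \<and>
     (\<forall>\<mu> :: ('a + ('k \<rightharpoonup> ('f + 'r) + bool)) set rel. Card_order \<mu> \<and> LS_card \<kappa> N <o \<mu> \<longrightarrow>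
        (\<forall>M\<in>S. (\<forall>\<alpha>\<in>Field \<kappa>. card (underS \<kappa> \<alpha>) = 1 \<longrightarrow> saturated_len \<kappa> N \<mu> \<alpha> M) \<longrightarrow>
               saturated \<kappa> N \<mu> M))"

definition order_property ::
    "'k rel \<Rightarrow> ('f, 'r, 'k, 'a, 'm) struct_scheme \<Rightarrow> 'c rel \<Rightarrow> bool" where
  "order_property \<kappa> N \<chi> \<longleftrightarrow>
     (\<exists>\<alpha>\<in>Field \<kappa>. \<exists>\<phi>\<in>qf_fms \<kappa> N (vars \<kappa> \<alpha> \<alpha>). \<exists>a. (\<forall>i\<in>Field \<chi>. a i \<in> tuples \<kappa> \<alpha> UNIV) \<and>
        (\<forall>i\<in>Field \<chi>. \<forall>j\<in>Field \<chi>. sat N \<phi> (a i) (a j) \<longleftrightarrow> i \<in> underS \<chi> j))"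

text \<open>
  A sequence is given by its index order \<open>I\<close>, a relation with \<open>Linear_order I\<close>, and the function \<open>a\<close>
  on \<open>Field I\<close>.
\<close>

definition Av ::
    "'k rel \<Rightarrow> ('f, 'r, 'k, 'a, 'm) struct_scheme \<Rightarrow> 'c rel \<Rightarrow> 'k \<Rightarrow> 'i rel \<Rightarrow> ('i \<Rightarrow> ('k \<rightharpoonup> 'a))
      \<Rightarrow> 'a set \<Rightarrow> ('f, 'r, 'k, 'a) pfm set" where
  "Av \<kappa> N \<chi> \<alpha> I a A = {(\<phi>, b) \<in> fms_over \<kappa> N \<alpha> A. |{c \<in> a ` Field I. \<not> sat N \<phi> c b}| <o \<chi>}"

definition convergent ::
    "'k rel \<Rightarrow> ('f, 'r, 'k, 'a, 'm) struct_scheme \<Rightarrow> 'c rel \<Rightarrow> 'i rel \<Rightarrow> ('i \<Rightarrow> ('k \<rightharpoonup> 'a)) \<Rightarrow> bool" where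
  "convergent \<kappa> N \<chi> I a \<longleftrightarrow>
     (\<exists>\<alpha>\<in>Field \<kappa>. a ` Field I \<subseteq> tuples \<kappa> \<alpha> UNIV \<and> \<chi> \<le>o |a ` Field I| \<and>
        (\<forall>A. complete_type \<kappa> N \<alpha> A (Av \<kappa> N \<chi> \<alpha> I a A)))"

definition splits ::
    "'k rel \<Rightarrow> ('f, 'r, 'k, 'a, 'm) struct_scheme \<Rightarrow> ('f, 'r, 'k, 'a) pfm set \<Rightarrow> 'a set \<Rightarrow> bool" where
  "splits \<kappa> N p A \<longleftrightarrow>
     (\<exists>\<beta>\<in>Field \<kappa>. \<exists>\<phi>. \<exists>b\<in>tuples \<kappa> \<beta> UNIV. \<exists>b'\<in>tuples \<kappa> \<beta> UNIV.
        (\<phi>, b) \<in> p \<and> tp \<kappa> N \<beta> b' A = tp \<kappa> N \<beta> b A \<and> (Neg \<phi>, b') \<in> p)"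

definition morley_for ::
    "'k rel \<Rightarrow> ('f, 'r, 'k, 'a, 'm) struct_scheme \<Rightarrow> 'a set set
      \<Rightarrow> 'c0 rel \<Rightarrow> 'c1 rel \<Rightarrow> 'c2 rel \<Rightarrow> 'k \<Rightarrow> ('f, 'r, 'k, 'a) pfm set \<Rightarrow> 'a set
      \<Rightarrow> 'i rel \<Rightarrow> ('i \<Rightarrow> ('k \<rightharpoonup> 'a)) \<Rightarrow> bool" where
  "morley_for \<kappa> N S \<chi>0 \<chi>1 \<chi>2 \<alpha> p A I a \<longleftrightarrow>
     (\<exists>M :: 'i \<Rightarrow> 'a set.
        (\<forall>i\<in>Field I. M i \<in> S \<and> a i \<in> tuples \<kappa> \<alpha> UNIV \<and> A \<subseteq> M i \<and> saturated \<kappa> N \<chi>1 (M i) \<and>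
           realizes N (a i) (restrict_fms p (M i)) \<and> \<not> splits \<kappa> N (tp \<kappa> N \<alpha> (a i) (M i)) A) \<and>
        |A| <o \<chi>0 \<and>
        (\<forall>j\<in>Field I. \<forall>i\<in>underS I j. M i \<subseteq> M j \<and> a i \<in> tuples \<kappa> \<alpha> (M j) \<and> a i \<noteq> a j \<and>
           tp \<kappa> N \<alpha> (a i) (M i) = tp \<kappa> N \<alpha> (a j) (M i)) \<and>
        \<chi>2 \<le>o |Field I| )"

definition morley ::
    "'k rel \<Rightarrow> ('f, 'r, 'k, 'a, 'm) struct_scheme \<Rightarrow> 'a set set
      \<Rightarrow> 'c0 rel \<Rightarrow> 'c1 rel \<Rightarrow> 'c2 rel \<Rightarrow> 'i rel \<Rightarrow> ('i \<Rightarrow> ('k \<rightharpoonup> 'a)) \<Rightarrow> bool" where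
  "morley \<kappa> N S \<chi>0 \<chi>1 \<chi>2 I a \<longleftrightarrow>
     (\<exists>\<alpha>\<in>Field \<kappa>. \<exists>p\<subseteq>fms_over \<kappa> N \<alpha> UNIV. \<exists>A. morley_for \<kappa> N S \<chi>0 \<chi>1 \<chi>2 \<alpha> p A I a)"

end

theory Submission
  imports Defs
begin

text \<open>
  Fix \<open>\<phi>(x, b)\<close> and suppose that both \<open>\<phi>(x, b)\<close> and its negation hold at more than \<open>2\<^sup>\<chi>\<^sup>0\<close> members of
  the sequence.  Saturation yields copies \<open>b'\<close> in the models of the type of \<open>b\<close> over \<open>A\<close>, and since
  the types of the \<open>a\<^sub>i\<close> cohere and do not split over \<open>A\<close>, the truth value of \<open>\<phi>(a\<^sub>j, b')\<close> for all \<open>j\<close>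
  from the model containing \<open>b'\<close> on is the same for all copies.  Replacing \<open>\<phi>\<close> by its negation if
  necessary, it is false, although \<open>\<phi>(a\<^sub>i, b)\<close> holds for all \<open>i\<close> in a set \<open>X\<close> with more than \<open>2\<^sup>\<chi>\<^sup>0\<close>
  elements.  A subsequence of \<open>X\<close> of length \<open>\<chi>\<^sub>0\<^sup>+\<close> then produces the order property.  If it is
  increasing, copy \<open>b\<close> over \<open>A\<close> and an initial segment.  If it is decreasing, copies over sets of size
  \<open>\<chi>\<^sub>0\<close> do not control the whole sequence, so it is chosen by the tree argument of the Erdos-Rado
  theorem: it is end-homogeneous for a colouring that refers to copies of \<open>b\<close> over the tree
  predecessors.
\<close>

section \<open>Cardinal bounds and end-homogeneous sequences\<close>

lemma card_of_underS_cardSuc: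
  assumes "Card_order r" "i \<in> Field (cardSuc r)"
  shows "|underS (cardSuc r) i| \<le>o r"
proof -
  have "|underS (cardSuc r) i| <o cardSuc r"
    using assms by (intro card_of_underS) (auto simp: cardSuc_Card_order)
  then show ?thesis
    using assms(1) by (simp add: cardSuc_ordLeq_ordLess card_of_Card_order)
qed

lemma card_of_Pow_ordLeq_cexp:
  assumes "Card_order r" "|A| \<le>o r"
  shows "|Pow A| \<le>o ctwo ^c r"
proof -
  have "|A| \<le>o |Field r|"
    using assms card_of_Field_ordIso ordIso_symmetric ordLeq_ordIso_trans by blast
  then obtain f where "inj_on f A" "f ` A \<subseteq> Field r"
    by (metis card_of_ordLeq)
  then have "|Pow A| \<le>o |Pow (Field r)|"
    by (intro card_of_ordLeqI[of "image f"]) (auto intro: inj_on_image_Pow)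
  also have "|Pow (Field r)| =o ctwo ^c r"
    using card_of_Pow_Func[of "Field r"] by (simp add: cexp_def ctwo_def Field_card_of)
  finally show ?thesis .
qed

text \<open>
  For \<open>\<delta> \<in> X\<close> build a sequence that imitates \<open>\<delta>\<close>.  It stops when it reaches \<open>\<delta>\<close>, and then \<open>\<delta>\<close> is
  determined by the at most \<open>r\<close> colours met on the way; there are only \<open>2\<^sup>r\<close> such codes.
\<close>

lemma end_homogeneous_sequence:
  fixes r :: "'c rel" and X :: "'x set" and P :: "('c set \<Rightarrow> 'x) \<Rightarrow> 'c set \<Rightarrow> 'c set \<Rightarrow> 'x \<Rightarrow> bool"
  assumes r: "Cinfinite r" and X: "ctwo ^c r <o |X|"
    and cong: "\<And>f g i k x. \<lbrakk>i \<in> under (cardSuc r) k; \<forall>m\<in>under (cardSuc r) k. f m = g m\<rbrakk>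
      \<Longrightarrow> P f i k x \<longleftrightarrow> P g i k x"
  obtains g where "g ` Field (cardSuc r) \<subseteq> X" "inj_on g (Field (cardSuc r))"
    "\<And>i k m n. \<lbrakk>i \<in> under (cardSuc r) k; k \<in> underS (cardSuc r) m; k \<in> underS (cardSuc r) n\<rbrakk>
      \<Longrightarrow> P g i k (g m) \<longleftrightarrow> P g i k (g n)"
proof -
  let ?R = "cardSuc r"
  have R: "Card_order ?R" and WO: "Well_order ?R"
    using r cardSuc_Card_order card_order_on_well_order_on by auto
  interpret wo: wo_rel ?R
    using WO by (simp add: wo_rel_def)
  \<comment> \<open>The next entry is any fresh element of \<open>X\<close> that has the same
    colours as \<open>\<delta>\<close> at all earlier pairs. As long as \<open>\<delta>\<close> has
    not occurred, it is itself a candidate.\<close>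
  define H where "H \<delta> f i = (SOME x. x \<in> X \<and> (\<forall>k\<in>underS ?R i. x \<noteq> f k \<and>
      (\<forall>j\<in>under ?R k. P f j k x \<longleftrightarrow> P f j k \<delta>)))" for \<delta> f i
  define g where "g \<delta> = wo.worec (H \<delta>)" for \<delta>
  have under_sub: "under ?R k \<subseteq> underS ?R i" if "k \<in> underS ?R i" for k i
    using that wo.TRANS wo.ANTISYM unfolding under_def underS_def by (auto dest: transD antisymD)
  \<comment> \<open>By \<open>cong\<close>, a colour at \<open>k\<close> depends only on the entries
    up to \<open>k\<close>, so \<open>H\<close> at stage \<open>i\<close> looks only below
    \<open>i\<close> and the recursion is well defined.\<close>
  have adm: "wo.adm_wo (H \<delta>)" for \<delta>
    unfolding wo.adm_wo_def
  proof (intro allI impI)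
    fix f f' :: "'c set \<Rightarrow> 'x" and i assume eq: "\<forall>k\<in>underS ?R i. f k = f' k"
    have "P f j k x = P f' j k x" if "k \<in> underS ?R i" "j \<in> under ?R k" for j k x
      using that eq under_sub by (intro cong) blast+
    then show "H \<delta> f i = H \<delta> f' i"
      unfolding H_def using eq by (intro arg_cong[where f = Eps] ext) auto
  qed
  have g: "g \<delta> i = H \<delta> (g \<delta>) i" for \<delta> i
    unfolding g_def using wo.worec_fixpoint[OF adm] by metis
  have "\<exists>\<delta>\<in>X. \<forall>i\<in>Field ?R. g \<delta> i \<noteq> \<delta>"
  proof (rule ccontr)
    assume "\<not> ?thesis"
    then have ex: "\<exists>i\<in>Field ?R. g \<delta> i = \<delta>" if "\<delta> \<in> X" for \<delta>
      using that by blast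
    define l where "l \<delta> = (SOME i. i \<in> Field ?R \<and> g \<delta> i = \<delta>)" for \<delta>
    have l: "l \<delta> \<in> Field ?R" "g \<delta> (l \<delta>) = \<delta>" if "\<delta> \<in> X" for \<delta>
      using someI_ex[of "\<lambda>i. i \<in> Field ?R \<and> g \<delta> i = \<delta>"] ex[OF that] unfolding l_def by blast+
    \<comment> \<open>The code of \<open>\<delta>\<close>: the stage where it occurs and the colours
      it has at the pairs before that stage. The choice made by \<open>H\<close> refers to
      \<open>\<delta>\<close> only through these colours, so equal codes give equal
      sequences.\<close>
    define W where "W \<delta> = {(j, k). k \<in> underS ?R (l \<delta>) \<and> j \<in> under ?R k \<and> P (g \<delta>) j k \<delta>}" for \<delta>
    define cd where "cd \<delta> = (l \<delta>, W \<delta>)" for \<delta>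
    let ?C = "SIGMA i : Field ?R. Pow (underS ?R i \<times> underS ?R i)"
    have "cd ` X \<subseteq> ?C"
      using l(1) under_sub unfolding cd_def W_def by fastforce
    moreover have "inj_on cd X"
    proof
      fix \<delta> \<delta>' assume X': "\<delta> \<in> X" "\<delta>' \<in> X" and "cd \<delta> = cd \<delta>'"
      then have leq: "l \<delta> = l \<delta>'" and Weq: "W \<delta> = W \<delta>'"
        by (auto simp: cd_def)
      \<comment> \<open>The agreement has to include stage \<open>l \<delta>\<close> itself, because
        the entries there are \<open>\<delta>\<close> and \<open>\<delta>'\<close>.\<close>
      have "i \<in> under ?R (l \<delta>) \<longrightarrow> g \<delta> i = g \<delta>' i" for i
      proof (induction i rule: wo.well_order_induct)
        case (1 i)
        show ?case
        proof
          assume i: "i \<in> under ?R (l \<delta>)"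
          have sub: "underS ?R i \<subseteq> underS ?R (l \<delta>)"
            using i wo.TRANS wo.ANTISYM unfolding under_def underS_def by (auto dest: transD antisymD)
          have IH: "g \<delta> k = g \<delta>' k" if "k \<in> underS ?R i" for k
            using 1 that sub unfolding underS_def under_def by auto
          have "P (g \<delta>) j k \<delta> = P (g \<delta>') j k \<delta>'" if "k \<in> underS ?R i" "j \<in> under ?R k" for j k
          proof -
            have "P (g \<delta>) j k \<delta> \<longleftrightarrow> (j, k) \<in> W \<delta>" "P (g \<delta>') j k \<delta>' \<longleftrightarrow> (j, k) \<in> W \<delta>'"
              using that sub leq unfolding W_def by auto
            then show ?thesis using Weq by simp
          qed
          moreover have "P (g \<delta>) j k x = P (g \<delta>') j k x" if "k \<in> underS ?R i" "j \<in> under ?R k" for j k x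
            using that IH under_sub by (intro cong) blast+
          ultimately have "H \<delta> (g \<delta>) i = H \<delta>' (g \<delta>') i"
            unfolding H_def using IH by (intro arg_cong[where f = Eps] ext) auto
          then show "g \<delta> i = g \<delta>' i"
            using g by metis
        qed
      qed
      moreover have "l \<delta> \<in> under ?R (l \<delta>)"
        using l(1)[OF X'(1)] wo.REFL unfolding under_def refl_on_def by blast
      ultimately show "\<delta> = \<delta>'"
        using l(2)[OF X'(1)] l(2)[OF X'(2)] leq by metis
    qed
    ultimately have "|X| \<le>o |?C|"
      by (intro card_of_ordLeqI[of cd]) blast+
    \<comment> \<open>There are \<open>r\<^sup>+ \<le> 2\<^sup>r\<close> stages, and each has at
      most \<open>r\<close> pairs below it, hence at most \<open>2\<^sup>r\<close> sets of
      pairs.\<close>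
    also have "|?C| \<le>o ctwo ^c r"
    proof (rule card_of_Sigma_ordLeq_infinite_Field)
      show "infinite (Field (ctwo ^c r))"
        using r Cinfinite_cexp[of ctwo r] by (auto simp: cinfinite_def ordLeq_refl Card_order_ctwo)
      show "Card_order (ctwo ^c r)" by (rule Card_order_cexp)
      have "?R \<le>o ctwo ^c r"
        using r by (intro cardSuc_least ordLess_ctwo_cexp Card_order_cexp) auto
      then show "|Field ?R| \<le>o ctwo ^c r"
        using card_of_Field_ordIso[OF R] ordIso_ordLeq_trans by blast
      show "\<forall>i\<in>Field ?R. |Pow (underS ?R i \<times> underS ?R i)| \<le>o ctwo ^c r"
      proof
        fix i assume "i \<in> Field ?R"
        then have "|underS ?R i| \<le>o r"
          using r by (intro card_of_underS_cardSuc) auto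
        then have "|underS ?R i \<times> underS ?R i| \<le>o r"
          using r by (intro card_of_Times_ordLeq_infinite_Field) (auto simp: cinfinite_def)
        then show "|Pow (underS ?R i \<times> underS ?R i)| \<le>o ctwo ^c r"
          using r by (intro card_of_Pow_ordLeq_cexp) auto
      qed
    qed
    finally show False
      using not_ordLess_ordLeq[OF X] by contradiction
  qed
  then obtain \<delta> where \<delta>: "\<delta> \<in> X" "\<And>i. i \<in> Field ?R \<Longrightarrow> g \<delta> i \<noteq> \<delta>"
    by blast
  have underS_Field: "k \<in> Field ?R" "i \<in> Field ?R" if "k \<in> underS ?R i" for k i
    using that by (auto simp: underS_def Field_def)
  \<comment> \<open>For this \<open>\<delta>\<close> the choice never fails, as
    \<open>\<delta>\<close> always remains a candidate. All entries after \<open>k\<close> then have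
    the colours of \<open>\<delta>\<close> at \<open>k\<close>, and so they agree with each
    other.\<close>
  have props: "g \<delta> i \<in> X \<and> (\<forall>k\<in>underS ?R i. g \<delta> i \<noteq> g \<delta> k \<and>
      (\<forall>j\<in>under ?R k. P (g \<delta>) j k (g \<delta> i) \<longleftrightarrow> P (g \<delta>) j k \<delta>))" for i
  proof -
    have "\<exists>x. x \<in> X \<and> (\<forall>k\<in>underS ?R i. x \<noteq> g \<delta> k \<and>
        (\<forall>j\<in>under ?R k. P (g \<delta>) j k x \<longleftrightarrow> P (g \<delta>) j k \<delta>))"
      using \<delta> underS_Field by metis
    from someI_ex[OF this] show ?thesis
      unfolding H_def[symmetric] g[symmetric] .
  qed
  show ?thesis
  proof
    show "g \<delta> ` Field ?R \<subseteq> X" using props by blast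
    show "inj_on (g \<delta>) (Field ?R)"
    proof
      fix i j assume "i \<in> Field ?R" "j \<in> Field ?R" "g \<delta> i = g \<delta> j"
      moreover have "i = j \<or> i \<in> underS ?R j \<or> j \<in> underS ?R i"
        using calculation wo.TOTALS by (auto simp: underS_def)
      ultimately show "i = j" using props by metis
    qed
    show "P (g \<delta>) i k (g \<delta> m) \<longleftrightarrow> P (g \<delta>) i k (g \<delta> n)"
      if "i \<in> under ?R k" "k \<in> underS ?R m" "k \<in> underS ?R n" for i k m n
      using props that by blast
  qed
qed

text \<open>A set \<open>K\<close> with more than \<open>r\<close> elements has size at least
  \<open>r\<^sup>+\<close>, and its inherited well-order is at least as long as its cardinality, so
  \<open>cardSuc r\<close> embeds in it. This is how a large set of stages is thinned out to a
  subsequence of full length.\<close>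

lemma cardSuc_embed_subset:
  assumes r: "Card_order r" and K: "K \<subseteq> Field (cardSuc r)" "\<not> |K| \<le>o r"
  obtains f where "f ` Field (cardSuc r) \<subseteq> K"
    "\<And>i j. i \<in> underS (cardSuc r) j \<Longrightarrow> f i \<in> underS (cardSuc r) (f j)"
proof -
  let ?R = "cardSuc r"
  have R: "Card_order ?R" and WO: "Well_order ?R"
    using r cardSuc_Card_order card_order_on_well_order_on by auto
  have "r <o |K|"
    using K(2) r by (meson card_of_Well_order card_order_on_well_order_on not_ordLeq_iff_ordLess)
  then have "?R \<le>o |K|"
    using r by (intro cardSuc_least) (auto simp: card_of_Card_order)
  also have "well_order_on K (Restr ?R K)"
    using WO K(1) by (rule well_order_on_Restr)
  then have "|K| \<le>o Restr ?R K"
    by (rule card_of_least)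
  finally obtain f where f: "embed ?R (Restr ?R K) f"
    by (auto simp: ordLeq_def)
  have WO': "Well_order (Restr ?R K)" using WO by (rule Well_order_Restr)
  have "inj_on f (Field ?R)" using embed_inj_on[OF WO f] .
  moreover have "compat ?R (Restr ?R K) f" using embed_compat[OF f] .
  moreover have "f ` Field ?R \<subseteq> Field (Restr ?R K)" using embed_Field[OF f] .
  moreover have "Field (Restr ?R K) \<subseteq> K" by (auto simp: Field_def)
  ultimately show ?thesis
    by (intro that[of f]) (auto simp: compat_def underS_def Field_def inj_on_def)
qed

section \<open>Renaming of variables\<close>

primrec rename_trm :: "('k var \<Rightarrow> 'k var) \<Rightarrow> ('f, 'k) trm \<Rightarrow> ('f, 'k) trm" where
  "rename_trm h (Var v) = Var (h v)"
| "rename_trm h (Fun f ts) = Fun f (\<lambda>i. map_option (rename_trm h) (ts i))"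

primrec rename_fm :: "('k var \<Rightarrow> 'k var) \<Rightarrow> ('f, 'r, 'k) fm \<Rightarrow> ('f, 'r, 'k) fm" where
  "rename_fm h (Eq s t) = Eq (rename_trm h s) (rename_trm h t)"
| "rename_fm h (Rel R ts) = Rel R (\<lambda>i. map_option (rename_trm h) (ts i))"
| "rename_fm h (Neg \<phi>) = Neg (rename_fm h \<phi>)"
| "rename_fm h (Conj \<Phi>) = Conj (\<lambda>i. map_option (rename_fm h) (\<Phi> i))"

lemma dom_map_option_apply: "dom (\<lambda>i. map_option f (m i)) = dom m"
  by (auto simp: dom_def)

lemma ran_map_option_apply: "ran (\<lambda>i. map_option f (m i)) = f ` ran m"
  by (auto simp: ran_def)

lemma rename_trm_in_terms:
  assumes "t \<in> terms \<kappa> L V" "h ` V \<subseteq> V'"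
  shows "rename_trm h t \<in> terms \<kappa> L V'"
  using assms(1)
proof induction
  case (1 v)
  then show ?case using assms(2) by (auto intro: terms.intros)
next
  case (2 f ts)
  then show ?case
    by (simp, intro terms.intros) (auto simp: dom_map_option_apply ran_map_option_apply)
qed

lemma rename_fm_in_qf_fms:
  assumes "\<phi> \<in> qf_fms \<kappa> L V" "h ` V \<subseteq> V'"
  shows "rename_fm h \<phi> \<in> qf_fms \<kappa> L V'"
  using assms(1)
proof induction
  case (2 R ts)
  have "\<forall>t\<in>terms \<kappa> L V. rename_trm h t \<in> terms \<kappa> L V'"
    using assms(2) by (auto intro: rename_trm_in_terms)
  with 2 show ?case
    by (simp, intro qf_fms.intros) (auto simp: tuples_def dom_map_option_apply ran_map_option_apply)
next
  case (4 \<alpha> \<Phi>)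
  then show ?case
    by (simp, intro qf_fms.intros) (auto simp: dom_map_option_apply ran_map_option_apply)
qed (auto intro!: qf_fms.intros intro: rename_trm_in_terms[OF _ assms(2)])

lemma trm_val_rename:
  assumes "t \<in> terms \<kappa> L V" "\<And>v. v \<in> V \<Longrightarrow> e' (h v) = e v"
  shows "trm_val N e' (rename_trm h t) = trm_val N e t"
  using assms(1)
proof induction
  case (1 v)
  then show ?case using assms(2) by simp
next
  case (2 f ts)
  have "map_option (trm_val N e') (map_option (rename_trm h) (ts i)) = map_option (trm_val N e) (ts i)" for i
    using 2 by (cases "ts i") (auto dest: ranI)
  then show ?case by simp
qed

lemma fm_val_rename:
  assumes "\<phi> \<in> qf_fms \<kappa> L V" "\<And>v. v \<in> V \<Longrightarrow> e' (h v) = e v"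
  shows "fm_val N e' (rename_fm h \<phi>) = fm_val N e \<phi>"
  using assms(1)
proof induction
  case (1 s t)
  then show ?case
    using trm_val_rename[of _ \<kappa> L V e' h e N] assms(2) by simp
next
  case (2 R ts)
  have "map_option (trm_val N e') (map_option (rename_trm h) (ts i)) = map_option (trm_val N e) (ts i)" for i
  proof (cases "ts i")
    case (Some t)
    then have "t \<in> terms \<kappa> L V" using 2 by (auto simp: tuples_def dest: ranI)
    then show ?thesis using trm_val_rename[of t \<kappa> L V e' h e N] assms(2) Some by simp
  qed simp
  then show ?case by simp
next
  case (4 \<alpha> \<Phi>)
  have "pred_option (fm_val N e') (map_option (rename_fm h) (\<Phi> i)) = pred_option (fm_val N e) (\<Phi> i)" for i
    using 4 by (cases "\<Phi> i") (auto dest: ranI)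
  then show ?case by simp
qed simp

lemma sat_Neg [simp]: "sat N (Neg \<phi>) c b \<longleftrightarrow> \<not> sat N \<phi> c b"
  by (simp add: sat_def)

text \<open>In the type of a parameter tuple \<open>b\<close>, the entries of \<open>b\<close>
  occupy the \<open>VX\<close> variables. Exchanging the two kinds of variables lets
  \<open>\<phi>(a, b)\<close> be read as a formula about \<open>b\<close> with parameters
  \<open>a\<close>.\<close>

lemma swap_variables:
  assumes "\<phi> \<in> qf_fms \<kappa> L (vars \<kappa> \<alpha> \<beta>)"
  obtains \<psi> where "\<psi> \<in> qf_fms \<kappa> L (vars \<kappa> \<beta> \<alpha>)" "\<And>c b. sat N \<psi> b c \<longleftrightarrow> sat N \<phi> c b"
proof
  let ?h = "\<lambda>v. case v of VX i \<Rightarrow> VY i | VY i \<Rightarrow> VX i"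
  show "rename_fm ?h \<phi> \<in> qf_fms \<kappa> L (vars \<kappa> \<beta> \<alpha>)"
    using assms by (rule rename_fm_in_qf_fms) (auto simp: vars_def)
  show "sat N (rename_fm ?h \<phi>) b c \<longleftrightarrow> sat N \<phi> c b" for c b
    unfolding sat_def using assms by (rule fm_val_rename) (auto split: var.split)
qed

section \<open>The order property for two sequences of tuples\<close>

text \<open>The disjoint sum of the two index sets has size below \<open>\<kappa>\<close> and so is
  in bijection with a proper initial segment. This stands in for ordinal addition, since only the
  positions matter and not their order.\<close>

lemma disjoint_ordinal_embeddings:
  assumes \<kappa>: "Cinfinite \<kappa>" and "\<alpha> \<in> Field \<kappa>" "\<beta> \<in> Field \<kappa>"
  obtains \<zeta> f g where "\<zeta> \<in> Field \<kappa>" "inj_on f (underS \<kappa> \<alpha>)" "inj_on g (underS \<kappa> \<beta>)"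
    "f ` underS \<kappa> \<alpha> \<subseteq> underS \<kappa> \<zeta>" "g ` underS \<kappa> \<beta> \<subseteq> underS \<kappa> \<zeta>"
    "f ` underS \<kappa> \<alpha> \<inter> g ` underS \<kappa> \<beta> = {}"
proof -
  let ?S = "underS \<kappa> \<alpha> <+> underS \<kappa> \<beta>"
  have WO: "Well_order \<kappa>"
    using \<kappa> by (simp add: card_order_on_well_order_on)
  have "|?S| <o \<kappa>"
    using assms by (intro card_of_Plus_ordLess_infinite_Field card_of_underS) (auto simp: cinfinite_def)
  then obtain \<zeta> where \<zeta>: "\<zeta> \<in> Field \<kappa>" "|?S| =o Restr \<kappa> (underS \<kappa> \<zeta>)"
    using WO card_of_Well_order ordLess_iff_ordIso_Restr by blast
  have "Field (Restr \<kappa> (underS \<kappa> \<zeta>)) = underS \<kappa> \<zeta>"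
    using WO by (intro Refl_Field_Restr2)
      (auto simp: order_on_defs well_order_on_def underS_def Field_def)
  then have "|?S| =o |underS \<kappa> \<zeta>|"
    using card_of_cong[OF \<zeta>(2)] by (simp add: Field_card_of)
  then obtain h where h: "inj_on h ?S" "h ` ?S \<subseteq> underS \<kappa> \<zeta>"
    using card_of_ordLeq[of ?S "underS \<kappa> \<zeta>"] ordIso_iff_ordLeq by blast
  show ?thesis
  proof (rule that[of \<zeta> "h \<circ> Inl" "h \<circ> Inr"])
    show "inj_on (h \<circ> Inl) (underS \<kappa> \<alpha>)" "inj_on (h \<circ> Inr) (underS \<kappa> \<beta>)"
      using h(1) by (auto simp: inj_on_def)
    show "(h \<circ> Inl) ` underS \<kappa> \<alpha> \<inter> (h \<circ> Inr) ` underS \<kappa> \<beta> = {}"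
      using h(1) by (auto simp: inj_on_def)
  qed (use \<zeta>(1) h(2) in auto)
qed

text \<open>\<open>order_property\<close> plugs one sequence into both places of the formula.
  Merging \<open>a i\<close> and \<open>b i\<close> into a single tuple reduces to this: the renamed
  formula reads the \<open>a\<close> part of its first argument and the \<open>b\<close> part of its
  second.\<close>

lemma order_property_bipartite:
  assumes \<kappa>: "Cinfinite \<kappa>" and \<alpha>\<beta>: "\<alpha> \<in> Field \<kappa>" "\<beta> \<in> Field \<kappa>"
    and \<phi>: "\<phi> \<in> qf_fms \<kappa> N (vars \<kappa> \<alpha> \<beta>)"
    and ab: "\<And>i. i \<in> Field \<chi> \<Longrightarrow> a i \<in> tuples \<kappa> \<alpha> UNIV" "\<And>i. i \<in> Field \<chi> \<Longrightarrow> b i \<in> tuples \<kappa> \<beta> UNIV"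
    and ord: "\<And>i j. \<lbrakk>i \<in> Field \<chi>; j \<in> Field \<chi>\<rbrakk> \<Longrightarrow> sat N \<phi> (a i) (b j) \<longleftrightarrow> i \<in> underS \<chi> j"
  shows "order_property \<kappa> N \<chi>"
proof -
  let ?U = "underS \<kappa> \<alpha>" and ?V = "underS \<kappa> \<beta>"
  obtain \<zeta> f g where \<zeta>: "\<zeta> \<in> Field \<kappa>" and f: "inj_on f ?U" "f ` ?U \<subseteq> underS \<kappa> \<zeta>"
    and g: "inj_on g ?V" "g ` ?V \<subseteq> underS \<kappa> \<zeta>" and disj: "f ` ?U \<inter> g ` ?V = {}"
    using disjoint_ordinal_embeddings[OF \<kappa> \<alpha>\<beta>] by metis
  \<comment> \<open>\<open>Some undefined\<close> fills the positions outside both images, so that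
    the domain is exactly \<open>underS \<kappa> \<zeta>\<close>.\<close>
  define c where "c i z = (if z \<in> f ` ?U then a i (inv_into ?U f z)
    else if z \<in> g ` ?V then b i (inv_into ?V g z)
    else if z \<in> underS \<kappa> \<zeta> then Some undefined else None)" for i z
  define h where "h v = (case v of VX m \<Rightarrow> VX (f m) | VY n \<Rightarrow> VY (g n))" for v :: "'a var"
  have ca: "c i (f m) = a i m" if "m \<in> ?U" for i m
    using that f(1) by (simp add: c_def)
  have cb: "c i (g n) = b i n" if "n \<in> ?V" for i n
  proof -
    have "g n \<notin> f ` ?U" using that disj by blast
    then show ?thesis using that g(1) by (simp add: c_def)
  qed
  have c: "c i \<in> tuples \<kappa> \<zeta> UNIV" if i: "i \<in> Field \<chi>" for i
  proof -
    have "c i z \<noteq> None \<longleftrightarrow> z \<in> underS \<kappa> \<zeta>" for z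
    proof -
      consider m where "m \<in> ?U" "z = f m" | n where "n \<in> ?V" "z = g n" | "z \<notin> f ` ?U" "z \<notin> g ` ?V"
        by blast
      then show ?thesis
      proof cases
        case 1
        then have "a i m \<noteq> None" using ab(1)[OF i] by (auto simp: tuples_def)
        then show ?thesis using 1 ca f(2) by auto
      next
        case 2
        then have "b i n \<noteq> None" using ab(2)[OF i] by (auto simp: tuples_def)
        then show ?thesis using 2 cb g(2) by auto
      next
        case 3
        then show ?thesis by (simp add: c_def)
      qed
    qed
    then show ?thesis by (auto simp: tuples_def dom_def)
  qed
  have "sat N (rename_fm h \<phi>) (c i) (c j) \<longleftrightarrow> sat N \<phi> (a i) (b j)" for i j
    unfolding sat_def using \<phi>
    by (rule fm_val_rename) (auto simp: h_def vars_def ca cb)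
  moreover have "rename_fm h \<phi> \<in> qf_fms \<kappa> N (vars \<kappa> \<zeta> \<zeta>)"
    using \<phi> by (rule rename_fm_in_qf_fms) (use f(2) g(2) in \<open>auto simp: h_def vars_def\<close>)
  ultimately show ?thesis
    unfolding order_property_def using \<zeta> c ord by blast
qed

text \<open>Serves the decreasing case, where each \<open>b i\<close> separates the later
  \<open>a j\<close> from the others; after swapping the variables the \<open>b i\<close> come
  first.\<close>

lemma order_property_bipartite_swap:
  assumes \<kappa>: "Cinfinite \<kappa>" and \<alpha>\<beta>: "\<alpha> \<in> Field \<kappa>" "\<beta> \<in> Field \<kappa>"
    and \<phi>: "\<phi> \<in> qf_fms \<kappa> N (vars \<kappa> \<alpha> \<beta>)"
    and ab: "\<And>i. i \<in> Field \<chi> \<Longrightarrow> a i \<in> tuples \<kappa> \<alpha> UNIV" "\<And>i. i \<in> Field \<chi> \<Longrightarrow> b i \<in> tuples \<kappa> \<beta> UNIV"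
    and ord: "\<And>i j. \<lbrakk>i \<in> Field \<chi>; j \<in> Field \<chi>\<rbrakk> \<Longrightarrow> sat N \<phi> (a j) (b i) \<longleftrightarrow> i \<in> underS \<chi> j"
  shows "order_property \<kappa> N \<chi>"
proof -
  obtain \<psi> where \<psi>: "\<psi> \<in> qf_fms \<kappa> N (vars \<kappa> \<beta> \<alpha>)" "\<And>c b. sat N \<psi> b c \<longleftrightarrow> sat N \<phi> c b"
    using swap_variables[OF \<phi>] by metis
  show ?thesis
    by (rule order_property_bipartite[OF \<kappa> \<alpha>\<beta>(2,1) \<psi>(1) ab(2,1)]) (use \<psi>(2) ord in auto)
qed

section \<open>Types and sizes of parameter sets\<close>

lemma card_of_insert_ordLeq:
  assumes "Cinfinite r" "|B| \<le>o r"
  shows "|insert x B| \<le>o r"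
proof -
  have "|{x}| \<le>o |Field r|"
    using assms(1) by (intro card_of_singl_ordLeq) (auto simp: cinfinite_def)
  then have "|{x}| \<le>o r"
    using assms(1) card_of_Field_ordIso ordLeq_ordIso_trans by blast
  then have "|{x} \<union> B| \<le>o r"
    using assms by (intro card_of_Un_ordLeq_infinite_Field) (auto simp: cinfinite_def)
  then show ?thesis by simp
qed

text \<open>A type contains each formula or its negation, so an inclusion of such types is an
  equality.\<close>

lemma tp_eq_of_realizes:
  assumes "realizes N c' (tp \<kappa> N \<alpha> c A)"
  shows "tp \<kappa> N \<alpha> c' A = tp \<kappa> N \<alpha> c A"
proof -
  have "sat N \<phi> c' b \<longleftrightarrow> sat N \<phi> c b" if \<phi>: "(\<phi>, b) \<in> fms_over \<kappa> N \<alpha> A" for \<phi> b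
  proof -
    have "(Neg \<phi>, b) \<in> fms_over \<kappa> N \<alpha> A"
      using \<phi> by (auto simp: fms_over_def intro: qf_fms.intros)
    then show ?thesis
      using \<phi> assms unfolding realizes_def tp_def by fastforce
  qed
  then show ?thesis by (auto simp: tp_def)
qed

lemma tp_eqD:
  assumes "tp \<kappa> N \<alpha> c A = tp \<kappa> N \<alpha> c' A"
    and "\<phi> \<in> qf_fms \<kappa> N (vars \<kappa> \<alpha> \<beta>)" "\<beta> \<in> Field \<kappa>" "b \<in> tuples \<kappa> \<beta> A"
  shows "sat N \<phi> c b \<longleftrightarrow> sat N \<phi> c' b"
proof -
  have "(\<phi>, b) \<in> fms_over \<kappa> N \<alpha> A"
    using assms(2-4) by (auto simp: fms_over_def)
  then have "(\<phi>, b) \<in> tp \<kappa> N \<alpha> c A \<longleftrightarrow> sat N \<phi> c b" "(\<phi>, b) \<in> tp \<kappa> N \<alpha> c' A \<longleftrightarrow> sat N \<phi> c' b"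
    by (auto simp: tp_def)
  then show ?thesis using assms(1) by simp
qed

lemma tp_eq_mono:
  assumes "tp \<kappa> N \<alpha> c B = tp \<kappa> N \<alpha> c' B" "A \<subseteq> B"
  shows "tp \<kappa> N \<alpha> c A = tp \<kappa> N \<alpha> c' A"
proof -
  have "tp \<kappa> N \<alpha> d A = tp \<kappa> N \<alpha> d B \<inter> fms_over \<kappa> N \<alpha> A" for d
    using assms(2) by (fastforce simp: tp_def fms_over_def tuples_def)
  then show ?thesis using assms(1) by simp
qed

lemma card_of_ran_tuple:
  assumes "Card_order \<kappa>" "c \<in> tuples \<kappa> \<alpha> B"
  shows "|ran c| \<le>o \<kappa>"
proof -
  have "ran c \<subseteq> (\<lambda>i. the (c i)) ` Field \<kappa>"
  proof
    fix x assume "x \<in> ran c"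
    then obtain i where i: "c i = Some x" by (auto simp: ran_def)
    then have "i \<in> underS \<kappa> \<alpha>" using assms(2) by (auto simp: tuples_def)
    then have "i \<in> Field \<kappa>" by (auto simp: underS_def Field_def)
    then show "x \<in> (\<lambda>i. the (c i)) ` Field \<kappa>" using i by force
  qed
  then have "|ran c| \<le>o |Field \<kappa>|"
    by (meson card_of_image card_of_mono1 ordLeq_transitive)
  then show ?thesis
    using assms(1) card_of_Field_ordIso ordLeq_ordIso_trans by blast
qed

text \<open>The constant tuples of the various lengths below \<open>\<kappa>\<close> are already
  \<open>\<kappa>\<close> many different sequences. With \<open>\<kappa> \<le> \<chi>0\<close>,
  adding tuples to a parameter set of size \<open>\<chi>0\<close> keeps it small.\<close>

lemma LS_card_ge:
  assumes "Card_order \<kappa>"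
  shows "\<kappa> \<le>o LS_card \<kappa> N"
proof -
  let ?r = "card_lang N +c ctwo"
  obtain x where x: "x \<in> Field ?r"
    by (auto simp: csum_def ctwo_def Field_card_of)
  define c where "c \<alpha> i = (if i \<in> underS \<kappa> \<alpha> then Some x else None)" for \<alpha> i
  have dom: "dom (c \<alpha>) = underS \<kappa> \<alpha>" for \<alpha>
    by (auto simp: c_def dom_def)
  have "c \<alpha> \<in> tuples \<kappa> \<alpha> (Field ?r)" for \<alpha>
    using x dom by (auto simp: tuples_def c_def ran_def split: if_splits)
  moreover have "inj_on c (Field \<kappa>)"
  proof
    fix \<alpha> \<beta> assume *: "\<alpha> \<in> Field \<kappa>" "\<beta> \<in> Field \<kappa>" "c \<alpha> = c \<beta>"
    then have eq: "underS \<kappa> \<alpha> = underS \<kappa> \<beta>" using dom by metis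
    have "total_on (Field \<kappa>) \<kappa>"
      using assms by (auto simp: card_order_on_def well_order_on_def linear_order_on_def)
    then have "\<alpha> = \<beta> \<or> \<alpha> \<in> underS \<kappa> \<beta> \<or> \<beta> \<in> underS \<kappa> \<alpha>"
      using * by (auto simp: total_on_def underS_def)
    moreover have "\<alpha> \<notin> underS \<kappa> \<alpha>" "\<beta> \<notin> underS \<kappa> \<beta>" by (auto simp: underS_def)
    ultimately show "\<alpha> = \<beta>" using eq by blast
  qed
  ultimately have "|Field \<kappa>| \<le>o LS_card \<kappa> N"
    unfolding LS_card_def cexp_less_def by (intro card_of_ordLeqI[of c]) blast+
  then show ?thesis
    using assms card_of_Field_ordIso ordIso_ordLeq_trans ordIso_symmetric by blast
qed

section \<open>Coherent sequences over saturated models\<close>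

text \<open>A Morley sequence with its models \<open>M\<close> and base set \<open>A\<close> fixed;
  \<open>|A| < \<chi>0\<^sup>+\<close> takes the form \<open>|A| \<le> \<chi>0\<close>.\<close>

locale morley_setting =
  fixes \<kappa> :: "'k rel" and N :: "('f, 'r, 'k, 'a) struct" and \<chi>0 :: "'c rel"
    and \<alpha> :: 'k and I :: "'i rel" and a :: "'i \<Rightarrow> ('k \<rightharpoonup> 'a)" and M :: "'i \<Rightarrow> 'a set" and A :: "'a set"
  assumes \<kappa>: "Cinfinite \<kappa>" and \<chi>0: "Card_order \<chi>0" and \<kappa>_le: "\<kappa> \<le>o \<chi>0" and \<alpha>: "\<alpha> \<in> Field \<kappa>"
    and I: "Linear_order I"
    and A_le: "|A| \<le>o \<chi>0" and A_sub: "i \<in> Field I \<Longrightarrow> A \<subseteq> M i"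
    and saturated: "i \<in> Field I \<Longrightarrow> saturated \<kappa> N (cardSuc \<chi>0) (M i)"
    and a: "i \<in> Field I \<Longrightarrow> a i \<in> tuples \<kappa> \<alpha> UNIV"
    and M_mono: "i \<in> underS I j \<Longrightarrow> M i \<subseteq> M j"
    and a_M: "i \<in> underS I j \<Longrightarrow> a i \<in> tuples \<kappa> \<alpha> (M j)"
    and tp_eq: "i \<in> underS I j \<Longrightarrow> tp \<kappa> N \<alpha> (a i) (M i) = tp \<kappa> N \<alpha> (a j) (M i)"
    and not_splits: "i \<in> Field I \<Longrightarrow> \<not> splits \<kappa> N (tp \<kappa> N \<alpha> (a i) (M i)) A"
begin

lemma Cinfinite_\<chi>0: "Cinfinite \<chi>0"
  using \<kappa> \<chi>0 \<kappa>_le cinfinite_mono by blast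

lemma sat_iff_sat_later:
  assumes "(k, j) \<in> I" "\<beta> \<in> Field \<kappa>" "\<phi> \<in> qf_fms \<kappa> N (vars \<kappa> \<alpha> \<beta>)" "b \<in> tuples \<kappa> \<beta> (M k)"
  shows "sat N \<phi> (a j) b \<longleftrightarrow> sat N \<phi> (a k) b"
proof (cases "k = j")
  case False
  then have "k \<in> underS I j" using assms(1) by (simp add: underS_def)
  from tp_eqD[OF tp_eq[OF this] assms(3,2,4)] show ?thesis by simp
qed simp

text \<open>Saturation of \<open>M k\<close> is applied to the type of \<open>b\<close> over
  \<open>A\<close> and the entries of all \<open>a j\<close> with \<open>j \<in> J\<close>. These
  tuples lie in \<open>M k\<close> because \<open>J\<close> is below \<open>k\<close>, and each has
  at most \<open>\<chi>0\<close> entries, so the parameter set has size at most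
  \<open>\<chi>0\<close>.\<close>

lemma exists_in_model:
  assumes k: "k \<in> Field I" and \<beta>: "\<beta> \<in> Field \<kappa>" and b: "b \<in> tuples \<kappa> \<beta> UNIV"
    and J: "J \<subseteq> underS I k" "|J| \<le>o \<chi>0"
  shows "\<exists>b'\<in>tuples \<kappa> \<beta> (M k). tp \<kappa> N \<beta> b' A = tp \<kappa> N \<beta> b A \<and>
    (\<forall>\<phi>\<in>qf_fms \<kappa> N (vars \<kappa> \<alpha> \<beta>). \<forall>j\<in>J. sat N \<phi> (a j) b' \<longleftrightarrow> sat N \<phi> (a j) b)"
proof -
  let ?B = "A \<union> (\<Union>j\<in>J. ran (a j))"
  have inf: "infinite (Field \<chi>0)" using Cinfinite_\<chi>0 by (simp add: cinfinite_def)
  have aj: "a j \<in> tuples \<kappa> \<alpha> (M k)" if "j \<in> J" for j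
    using a_M J(1) that by blast
  have "|ran (a j)| \<le>o \<chi>0" if "j \<in> J" for j
    using card_of_ran_tuple[OF _ aj[OF that]] \<kappa> \<kappa>_le ordLeq_transitive by blast
  then have "|\<Union>j\<in>J. ran (a j)| \<le>o \<chi>0"
    using J(2) inf \<chi>0 by (intro card_of_UNION_ordLeq_infinite_Field) auto
  then have "|?B| \<le>o \<chi>0"
    using A_le inf \<chi>0 by (intro card_of_Un_ordLeq_infinite_Field)
  then have "|?B| <o cardSuc \<chi>0"
    using \<chi>0 by (simp add: cardSuc_ordLeq_ordLess card_of_Card_order)
  moreover have "?B \<subseteq> M k"
    using A_sub[OF k] aj unfolding tuples_def by blast
  moreover have "tp \<kappa> N \<beta> b ?B \<in> realized_types \<kappa> N \<beta> ?B"
    using b by (auto simp: realized_types_def)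
  ultimately obtain b' where b': "b' \<in> tuples \<kappa> \<beta> (M k)" "realizes N b' (tp \<kappa> N \<beta> b ?B)"
    using saturated[OF k] \<beta> unfolding saturated_def saturated_len_def by blast
  from tp_eq_of_realizes[OF this(2)] have eq: "tp \<kappa> N \<beta> b' ?B = tp \<kappa> N \<beta> b ?B" .
  show ?thesis
  proof (intro bexI[OF _ b'(1)] conjI ballI)
    show "tp \<kappa> N \<beta> b' A = tp \<kappa> N \<beta> b A"
      using eq by (rule tp_eq_mono) blast
    fix \<phi> j assume \<phi>: "\<phi> \<in> qf_fms \<kappa> N (vars \<kappa> \<alpha> \<beta>)" and j: "j \<in> J"
    obtain \<psi> where \<psi>: "\<psi> \<in> qf_fms \<kappa> N (vars \<kappa> \<beta> \<alpha>)" "\<And>c b. sat N \<psi> b c \<longleftrightarrow> sat N \<phi> c b"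
      using swap_variables[OF \<phi>] by metis
    have "a j \<in> tuples \<kappa> \<alpha> ?B"
      using aj[OF j] j by (auto simp: tuples_def)
    from tp_eqD[OF eq \<psi>(1) \<alpha> this] show "sat N \<phi> (a j) b' \<longleftrightarrow> sat N \<phi> (a j) b"
      using \<psi>(2) by simp
  qed
qed

section \<open>Extracting the order property\<close>

text \<open>If the conclusion fails, every copy of \<open>b\<close> over \<open>A\<close> in a model
  \<open>M k\<close> makes \<phi> false from \<open>k\<close> on, while it can be chosen to make
  \<phi> true at up to \<open>\<chi>0\<close> prescribed members of \<open>X\<close> below
  \<open>k\<close>. This contrast is arranged along a sequence of length
  \<open>\<chi>0\<^sup>+\<close>.\<close>

lemma exists_generic_solution:
  assumes op: "\<not> order_property \<kappa> N (cardSuc \<chi>0)"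
    and X: "X \<subseteq> Field I" "ctwo ^c \<chi>0 <o |X|"
    and \<beta>: "\<beta> \<in> Field \<kappa>" and \<phi>: "\<phi> \<in> qf_fms \<kappa> N (vars \<kappa> \<alpha> \<beta>)" and b: "b \<in> tuples \<kappa> \<beta> UNIV"
    and sat_X: "\<And>x. x \<in> X \<Longrightarrow> sat N \<phi> (a x) b"
  shows "\<exists>k\<in>Field I. \<exists>b'\<in>tuples \<kappa> \<beta> (M k). tp \<kappa> N \<beta> b' A = tp \<kappa> N \<beta> b A \<and> sat N \<phi> (a k) b'"
proof (rule ccontr)
  assume "\<not> ?thesis"
  then have neg: "\<not> sat N \<phi> (a j) b'"
    if "b' \<in> tuples \<kappa> \<beta> (M k)" "tp \<kappa> N \<beta> b' A = tp \<kappa> N \<beta> b A" "(k, j) \<in> I" for k j b'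
    using that sat_iff_sat_later[OF that(3) \<beta> \<phi> that(1)] by (auto simp: Field_def)
  let ?R = "cardSuc \<chi>0"
  have R: "Card_order ?R" and WO: "Well_order ?R"
    using \<chi>0 cardSuc_Card_order card_order_on_well_order_on by auto
  have inf: "infinite (Field \<chi>0)" using Cinfinite_\<chi>0 by (simp add: cinfinite_def)
  interpret wo: wo_rel ?R
    using WO by (simp add: wo_rel_def)
  have I_cases: "x = y \<or> x \<in> underS I y \<or> y \<in> underS I x" if "x \<in> Field I" "y \<in> Field I" for x y
    using I that by (auto simp: linear_order_on_def total_on_def underS_def)
  have underS_R: "k \<in> Field ?R" "m \<in> Field ?R" "k \<noteq> m" if "k \<in> underS ?R m" for k m
    using that by (auto simp: underS_def Field_def)
  have R_cases: "k = m \<or> k \<in> underS ?R m \<or> m \<in> underS ?R k" if "k \<in> Field ?R" "m \<in> Field ?R" for k m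
    using that wo.TOTALS by (auto simp: underS_def)
  have under_R: "under ?R k = insert k (underS ?R k)" if "k \<in> Field ?R" for k
    using that wo.REFL by (auto simp: under_def underS_def refl_on_def)
  have under_le: "|under ?R k| \<le>o \<chi>0" if "k \<in> Field ?R" for k
    using that under_R card_of_insert_ordLeq[OF Cinfinite_\<chi>0 card_of_underS_cardSuc[OF \<chi>0 that]] by simp
  have Field_R: "\<not> |Field ?R| \<le>o \<chi>0"
    using card_of_Field_ordIso[OF R] cardSuc_greater[OF \<chi>0] not_ordLess_ordLeq
      ordIso_symmetric ordLess_ordIso_trans by blast

  \<comment> \<open>A copy of \<open>b\<close> in the model at \<open>g i\<close> which keeps \<phi>
    true at the entries with index after \<open>i\<close> and up to \<open>k\<close>, as far as they
    lie below \<open>g i\<close> in \<open>I\<close>. In a decreasing sequence these are too many to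
    be treated at once, hence the bound \<open>k\<close>.\<close>
  define Q where "Q g i k c \<longleftrightarrow> c \<in> tuples \<kappa> \<beta> (M (g i)) \<and> tp \<kappa> N \<beta> c A = tp \<kappa> N \<beta> b A \<and>
      (\<forall>m\<in>under ?R k. i \<in> underS ?R m \<and> g m \<in> underS I (g i) \<longrightarrow> sat N \<phi> (a (g m)) c)" for g i k c
  define B where "B g i k = (SOME c. Q g i k c)" for g i k
  \<comment> \<open>Two colourings in one. The diagonal \<open>i = k\<close> records the position of
    \<open>x\<close> relative to \<open>g k\<close> in \<open>I\<close>; for \<open>i\<close> before
    \<open>k\<close> the colour is the truth value of \<phi> at the copy chosen for \<open>i\<close>
    and \<open>k\<close>.\<close>
  define P where "P g i k x \<longleftrightarrow> (if i = k then (x, g k) \<in> I else sat N \<phi> (a x) (B g i k))" for g i k x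
  have Q_cong: "Q f i k c \<longleftrightarrow> Q g i k c" if "i \<in> under ?R k" "\<forall>m\<in>under ?R k. f m = g m" for f g i k c
    using that by (simp add: Q_def)
  have B_cong: "B f i k = B g i k" if "i \<in> under ?R k" "\<forall>m\<in>under ?R k. f m = g m" for f g i k
    using Q_cong[OF that] by (simp add: B_def)
  have P_cong: "P f i k x \<longleftrightarrow> P g i k x" if "i \<in> under ?R k" "\<forall>m\<in>under ?R k. f m = g m" for f g i k x
    using B_cong[OF that] that unfolding P_def by auto
  obtain g where g: "g ` Field ?R \<subseteq> X" and inj: "inj_on g (Field ?R)"
    and hom: "\<And>i k m n. \<lbrakk>i \<in> under ?R k; k \<in> underS ?R m; k \<in> underS ?R n\<rbrakk>
      \<Longrightarrow> P g i k (g m) \<longleftrightarrow> P g i k (g n)"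
    using end_homogeneous_sequence[of \<chi>0 X P, OF Cinfinite_\<chi>0 X(2) P_cong] by metis
  have gX: "g i \<in> X" and gI: "g i \<in> Field I" if "i \<in> Field ?R" for i
    using g X(1) that by auto
  have Q: "Q g i k (B g i k)" if i: "i \<in> Field ?R" and k: "k \<in> Field ?R" for i k
  proof -
    let ?J = "{g m |m. m \<in> under ?R k \<and> i \<in> underS ?R m \<and> g m \<in> underS I (g i)}"
    have "|g ` under ?R k| \<le>o \<chi>0"
      using card_of_image under_le[OF k] ordLeq_transitive by blast
    then have J: "|?J| \<le>o \<chi>0"
      by (rule ordLeq_transitive[OF card_of_mono1, rotated]) blast
    have J': "?J \<subseteq> underS I (g i)" by blast
    obtain b' where b': "b' \<in> tuples \<kappa> \<beta> (M (g i))" "tp \<kappa> N \<beta> b' A = tp \<kappa> N \<beta> b A"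
      "\<forall>\<phi>\<in>qf_fms \<kappa> N (vars \<kappa> \<alpha> \<beta>). \<forall>j\<in>?J. sat N \<phi> (a j) b' \<longleftrightarrow> sat N \<phi> (a j) b"
      using exists_in_model[OF gI[OF i] \<beta> b J' J] by (elim bexE conjE)
    have "sat N \<phi> (a (g m)) b'" if "m \<in> under ?R k" "i \<in> underS ?R m" "g m \<in> underS I (g i)" for m
      using b'(3) \<phi> that sat_X[OF gX[OF underS_R(2)[OF that(2)]]] by blast
    then have "Q g i k b'"
      using b'(1,2) by (simp add: Q_def)
    then show ?thesis
      unfolding B_def by (rule someI[of "Q g i k"])
  qed
  have B_tuple: "B g i k \<in> tuples \<kappa> \<beta> UNIV" if "i \<in> Field ?R" "k \<in> Field ?R" for i k
    using Q[OF that] by (auto simp: Q_def tuples_def)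
  have a_tuple: "a (g i) \<in> tuples \<kappa> \<alpha> UNIV" if "i \<in> Field ?R" for i
    using a gI that by blast

  \<comment> \<open>End-homogeneity makes every \<open>g k\<close> lie above all later entries or below all of them.\<close>
  define D where "D = {k \<in> Field ?R. \<forall>m. k \<in> underS ?R m \<longrightarrow> g m \<in> underS I (g k)}"
  have notD: "g k \<in> underS I (g m)" if k: "k \<in> Field ?R - D" and m: "k \<in> underS ?R m" for k m
  proof -
    obtain n where n: "k \<in> underS ?R n" "g n \<notin> underS I (g k)"
      using k by (auto simp: D_def)
    have "k \<in> under ?R k" using under_R k by blast
    then have "(g m, g k) \<in> I \<longleftrightarrow> (g n, g k) \<in> I"
      using hom[of k k m n] m n(1) by (simp add: P_def)
    moreover have "g m \<noteq> g k" "g n \<noteq> g k"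
      using inj underS_R[OF m] underS_R[OF n(1)] by (auto simp: inj_on_def)
    ultimately have "g m \<notin> underS I (g k)" "g m \<noteq> g k"
      using n(2) by (auto simp: underS_def)
    then show ?thesis using I_cases gI underS_R[OF m] by metis
  qed
  have "\<not> |D| \<le>o \<chi>0 \<or> \<not> |Field ?R - D| \<le>o \<chi>0"
  proof (rule ccontr)
    assume "\<not> ?thesis"
    then have "|D \<union> (Field ?R - D)| \<le>o \<chi>0"
      using inf \<chi>0 by (intro card_of_Un_ordLeq_infinite_Field) auto
    moreover have "D \<union> (Field ?R - D) = Field ?R" by (auto simp: D_def)
    ultimately show False using Field_R by simp
  qed
  then show False
  proof
    \<comment> \<open>Increasing case: the entries before stage \<open>i\<close> lie below
      \<open>g (f i)\<close>, so a copy of \<open>b\<close> in that model can keep \<phi> true at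
      all of them, while \<open>neg\<close> makes \<phi> false from \<open>g (f i)\<close>
      on.\<close>
    assume "\<not> |Field ?R - D| \<le>o \<chi>0"
    then obtain f where f: "f ` Field ?R \<subseteq> Field ?R - D"
      and f_mono: "\<And>i j. i \<in> underS ?R j \<Longrightarrow> f i \<in> underS ?R (f j)"
      using cardSuc_embed_subset[OF \<chi>0, of "Field ?R - D"] by blast
    have fR: "f i \<in> Field ?R" if "i \<in> Field ?R" for i using f that by blast
    have "\<exists>c. c \<in> tuples \<kappa> \<beta> (M (g (f i))) \<and> tp \<kappa> N \<beta> c A = tp \<kappa> N \<beta> b A \<and>
        (\<forall>j\<in>underS ?R i. sat N \<phi> (a (g (f j))) c)" if i: "i \<in> Field ?R" for i
    proof -
      let ?J = "(\<lambda>j. g (f j)) ` underS ?R i"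
      have J: "|?J| \<le>o \<chi>0"
        using card_of_image card_of_underS_cardSuc[OF \<chi>0 i] ordLeq_transitive by blast
      have J': "?J \<subseteq> underS I (g (f i))"
      proof (rule image_subsetI)
        fix j assume j: "j \<in> underS ?R i"
        then have "f j \<in> Field ?R - D" using f underS_R(1) by blast
        from notD[OF this f_mono[OF j]] show "g (f j) \<in> underS I (g (f i))" .
      qed
      obtain b' where b': "b' \<in> tuples \<kappa> \<beta> (M (g (f i)))" "tp \<kappa> N \<beta> b' A = tp \<kappa> N \<beta> b A"
        "\<forall>\<phi>\<in>qf_fms \<kappa> N (vars \<kappa> \<alpha> \<beta>). \<forall>j\<in>?J. sat N \<phi> (a j) b' \<longleftrightarrow> sat N \<phi> (a j) b"
        using exists_in_model[OF gI[OF fR[OF i]] \<beta> b J' J] by (elim bexE conjE)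
      moreover have "sat N \<phi> (a (g (f j))) b'" if "j \<in> underS ?R i" for j
        using b'(3) \<phi> sat_X[OF gX[OF fR[OF underS_R(1)[OF that]]]] that by blast
      ultimately show ?thesis by blast
    qed
    then obtain c where c: "\<And>i. i \<in> Field ?R \<Longrightarrow> c i \<in> tuples \<kappa> \<beta> (M (g (f i)))"
      "\<And>i. i \<in> Field ?R \<Longrightarrow> tp \<kappa> N \<beta> (c i) A = tp \<kappa> N \<beta> b A"
      "\<And>i j. \<lbrakk>i \<in> Field ?R; j \<in> underS ?R i\<rbrakk> \<Longrightarrow> sat N \<phi> (a (g (f j))) (c i)"
      by metis
    have "order_property \<kappa> N ?R"
    proof (rule order_property_bipartite[OF \<kappa> \<alpha> \<beta> \<phi>])
      fix i assume "i \<in> Field ?R"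
      then show "a (g (f i)) \<in> tuples \<kappa> \<alpha> UNIV" "c i \<in> tuples \<kappa> \<beta> UNIV"
        using a_tuple fR c(1) by (auto simp: tuples_def)
    next
      fix j i assume j: "j \<in> Field ?R" and i: "i \<in> Field ?R"
      have "(g (f i), g (f j)) \<in> I" if "j \<notin> underS ?R i"
      proof (cases "i = j")
        case True
        then show ?thesis using I gI[OF fR[OF i]]
          by (auto simp: order_on_defs refl_on_def)
      next
        case False
        then have "i \<in> underS ?R j" using R_cases i j that by blast
        moreover have "f i \<in> Field ?R - D" using f i by blast
        ultimately show ?thesis using notD f_mono by (simp add: underS_def)
      qed
      then show "sat N \<phi> (a (g (f j))) (c i) \<longleftrightarrow> j \<in> underS ?R i"
        using neg[OF c(1)[OF i] c(2)[OF i]] c(3)[OF i] by blast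
    qed
    then show False using op by contradiction
  next
    \<comment> \<open>Decreasing case: for \<open>i\<close> in \<open>D\<close> the copy
      \<open>B g i k\<close> makes \<phi> true at all entries after \<open>i\<close> and up to
      \<open>k\<close>. Past \<open>k\<close>, end-homogeneity makes the truth value
      constant.\<close>
    assume D_large: "\<not> |D| \<le>o \<chi>0"
    have D_sub: "D \<subseteq> Field ?R" by (auto simp: D_def)
    have DI: "g m \<in> underS I (g i)" if "i \<in> D" "i \<in> underS ?R m" for i m
      using that by (simp add: D_def)
    have true_below: "sat N \<phi> (a (g m)) (B g i k)"
      if "i \<in> D" "i \<in> underS ?R m" "k \<in> Field ?R" "m \<in> under ?R k" for i m k
      using Q[of i k] that DI D_sub unfolding Q_def by blast
    have same_above: "sat N \<phi> (a (g m)) (B g i k) \<longleftrightarrow> sat N \<phi> (a (g n)) (B g i k)"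
      if "i \<in> underS ?R k" "k \<in> underS ?R m" "k \<in> underS ?R n" for i k m n
      using hom[of i k m n] that under_R underS_R by (auto simp: P_def)
    \<comment> \<open>The bounds \<open>k\<close> at which that constant value past \<open>k\<close>
      is false.\<close>
    define K where "K i = {k. i \<in> underS ?R k \<and>
        (\<exists>m. k \<in> underS ?R m \<and> \<not> sat N \<phi> (a (g m)) (B g i k))}" for i
    show False
    proof (cases "\<exists>i\<in>D. \<not> |K i| \<le>o \<chi>0")
      case True
      then obtain i where i: "i \<in> D" "\<not> |K i| \<le>o \<chi>0" by blast
      have "K i \<subseteq> Field ?R" by (auto simp: K_def dest: underS_R)
      then obtain f where f: "f ` Field ?R \<subseteq> K i"
        and f_mono: "\<And>i j. i \<in> underS ?R j \<Longrightarrow> f i \<in> underS ?R (f j)"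
        using cardSuc_embed_subset[OF \<chi>0 _ i(2)] by blast
      have fR: "f j \<in> Field ?R" and fi: "i \<in> underS ?R (f j)" if "j \<in> Field ?R" for j
        using f that by (auto simp: K_def dest: underS_R)
      \<comment> \<open>With \<open>i\<close> fixed and only the bound varying, \<phi> holds at the
        chosen entries up to \<open>f k\<close> and fails after it, so the negation of \<phi>
        defines the order.\<close>
      have "order_property \<kappa> N ?R"
      proof (rule order_property_bipartite_swap[OF \<kappa> \<alpha> \<beta> qf_fms.intros(3)[OF \<phi>]])
        fix j assume "j \<in> Field ?R"
        then show "a (g (f j)) \<in> tuples \<kappa> \<alpha> UNIV" "B g i (f j) \<in> tuples \<kappa> \<beta> UNIV"
          using a_tuple fR B_tuple i(1) D_sub by auto
      next
        fix k j assume k: "k \<in> Field ?R" and j: "j \<in> Field ?R"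
        have "sat N \<phi> (a (g (f j))) (B g i (f k))" if "k \<notin> underS ?R j"
        proof (rule true_below[OF i(1) fi[OF j] fR[OF k]])
          have "f j = f k \<or> f j \<in> underS ?R (f k)"
            using R_cases[OF k j] that f_mono by blast
          then show "f j \<in> under ?R (f k)" using under_R[OF fR[OF k]] by blast
        qed
        moreover have "\<not> sat N \<phi> (a (g (f j))) (B g i (f k))" if kj: "k \<in> underS ?R j"
        proof -
          obtain m where m: "f k \<in> underS ?R m" "\<not> sat N \<phi> (a (g m)) (B g i (f k))"
            using f k by (auto simp: K_def)
          then show ?thesis using same_above[OF fi[OF k] m(1) f_mono[OF kj]] by simp
        qed
        ultimately show "sat N (Neg \<phi>) (a (g (f j))) (B g i (f k)) \<longleftrightarrow> k \<in> underS ?R j"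
          by auto
      qed
      then show False using op by contradiction
    next
      case False
      \<comment> \<open>Only \<open>\<chi>0\<close> stages are at most \<open>i\<close> or in
        \<open>K i\<close>, so a bound \<open>k i\<close> is left over. Its copy makes \<phi> true
        up to \<open>k i\<close> and also past it, hence at every entry after
        \<open>i\<close>.\<close>
      have "\<exists>k. i \<in> underS ?R k \<and> k \<notin> K i" if i: "i \<in> D" for i
      proof (rule ccontr)
        assume "\<not> ?thesis"
        then have "Field ?R \<subseteq> under ?R i \<union> K i"
          using R_cases under_R i D_sub by blast
        moreover have "|under ?R i \<union> K i| \<le>o \<chi>0"
          using under_le[of i] i D_sub False inf \<chi>0 by (intro card_of_Un_ordLeq_infinite_Field) auto
        ultimately show False
          using Field_R card_of_mono1 ordLeq_transitive by blast
      qed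
      then obtain k where k: "\<And>i. i \<in> D \<Longrightarrow> i \<in> underS ?R (k i)" "\<And>i. i \<in> D \<Longrightarrow> k i \<notin> K i"
        by metis
      have true_above: "sat N \<phi> (a (g m)) (B g i (k i))" if i: "i \<in> D" and m: "i \<in> underS ?R m" for i m
      proof (cases "m \<in> under ?R (k i)")
        case True
        then show ?thesis using true_below[OF i m] underS_R(2)[OF k(1)[OF i]] by blast
      next
        case False
        then have "k i \<in> underS ?R m"
          using R_cases[of m "k i"] under_R underS_R(2)[OF k(1)[OF i]] underS_R(2)[OF m] by blast
        then show ?thesis using k[OF i] by (auto simp: K_def)
      qed
      obtain f where f: "f ` Field ?R \<subseteq> D"
        and f_mono: "\<And>i j. i \<in> underS ?R j \<Longrightarrow> f i \<in> underS ?R (f j)"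
        using cardSuc_embed_subset[OF \<chi>0 D_sub D_large] by blast
      have fD: "f i \<in> D" and fR: "f i \<in> Field ?R" if "i \<in> Field ?R" for i
        using f D_sub that by auto
      have kR: "k (f i) \<in> Field ?R" if "i \<in> Field ?R" for i
        using k(1)[OF fD[OF that]] underS_R by blast
      \<comment> \<open>Now the copy varies with the stage: \<phi> is true at later entries by
        \<open>true_above\<close>; the entry itself and the earlier ones lie at or above
        \<open>g (f i)\<close> in \<open>I\<close>, where \<open>neg\<close> makes it false.\<close>
      have "order_property \<kappa> N ?R"
      proof (rule order_property_bipartite_swap[OF \<kappa> \<alpha> \<beta> \<phi>])
        fix i assume "i \<in> Field ?R"
        then show "a (g (f i)) \<in> tuples \<kappa> \<alpha> UNIV" "B g (f i) (k (f i)) \<in> tuples \<kappa> \<beta> UNIV"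
          using a_tuple fR B_tuple kR by auto
      next
        fix i j assume i: "i \<in> Field ?R" and j: "j \<in> Field ?R"
        have "(g (f i), g (f j)) \<in> I" if "i \<notin> underS ?R j"
        proof (cases "i = j")
          case True
          then show ?thesis using I gI[OF fR[OF i]]
            by (auto simp: order_on_defs refl_on_def)
        next
          case False
          then have "j \<in> underS ?R i" using R_cases i j that by blast
          then show ?thesis using DI[OF fD[OF j] f_mono] by (auto simp: underS_def)
        qed
        moreover have "B g (f i) (k (f i)) \<in> tuples \<kappa> \<beta> (M (g (f i)))"
          "tp \<kappa> N \<beta> (B g (f i) (k (f i))) A = tp \<kappa> N \<beta> b A"
          using Q[OF fR[OF i] kR[OF i]] by (auto simp: Q_def)
        ultimately show "sat N \<phi> (a (g (f j))) (B g (f i) (k (f i))) \<longleftrightarrow> i \<in> underS ?R j"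
          using neg true_above[OF fD[OF i] f_mono] by blast
      qed
      then show False using op by contradiction
    qed
  qed
qed

text \<open>Otherwise \<phi> and its negation both have solutions at copies \<open>b1\<close>,
  \<open>b2\<close> of \<open>b\<close> over \<open>A\<close>. At the later index \<open>m\<close>
  of the two, both truth values persist, so the type of \<open>a m\<close> over \<open>M m\<close>
  splits over \<open>A\<close>.\<close>

lemma few_exceptions:
  assumes op: "\<not> order_property \<kappa> N (cardSuc \<chi>0)"
    and \<beta>: "\<beta> \<in> Field \<kappa>" and \<phi>: "\<phi> \<in> qf_fms \<kappa> N (vars \<kappa> \<alpha> \<beta>)" and b: "b \<in> tuples \<kappa> \<beta> UNIV"
  shows "\<not> ctwo ^c \<chi>0 <o |{i \<in> Field I. sat N \<phi> (a i) b}| \<or>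
    \<not> ctwo ^c \<chi>0 <o |{i \<in> Field I. \<not> sat N \<phi> (a i) b}|"
proof (rule ccontr)
  assume "\<not> ?thesis"
  then have large: "ctwo ^c \<chi>0 <o |{i \<in> Field I. sat N \<phi> (a i) b}|"
    "ctwo ^c \<chi>0 <o |{i \<in> Field I. \<not> sat N \<phi> (a i) b}|" by auto
  have "\<exists>k\<in>Field I. \<exists>b'\<in>tuples \<kappa> \<beta> (M k). tp \<kappa> N \<beta> b' A = tp \<kappa> N \<beta> b A \<and> sat N \<phi> (a k) b'"
    by (rule exists_generic_solution[OF op _ large(1) \<beta> \<phi> b]) auto
  then obtain k b1 where k: "k \<in> Field I" "b1 \<in> tuples \<kappa> \<beta> (M k)"
    "tp \<kappa> N \<beta> b1 A = tp \<kappa> N \<beta> b A" "sat N \<phi> (a k) b1" by blast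
  have "\<exists>k\<in>Field I. \<exists>b'\<in>tuples \<kappa> \<beta> (M k). tp \<kappa> N \<beta> b' A = tp \<kappa> N \<beta> b A \<and> sat N (Neg \<phi>) (a k) b'"
    by (rule exists_generic_solution[OF op _ large(2) \<beta> qf_fms.intros(3)[OF \<phi>] b]) auto
  then obtain l b2 where l: "l \<in> Field I" "b2 \<in> tuples \<kappa> \<beta> (M l)"
    "tp \<kappa> N \<beta> b2 A = tp \<kappa> N \<beta> b A" "\<not> sat N \<phi> (a l) b2" by auto
  have "(k, k) \<in> I" "(l, l) \<in> I" "(k, l) \<in> I \<or> (l, k) \<in> I"
    using I k(1) l(1) by (cases "k = l"; auto simp: order_on_defs refl_on_def total_on_def)+
  then obtain m where m: "(k, m) \<in> I" "(l, m) \<in> I" by blast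
  have M_le: "M i \<subseteq> M m" if "(i, m) \<in> I" for i
    using M_mono[of i m] that by (cases "i = m") (auto simp: underS_def)
  have sat_m: "sat N \<phi> (a m) b1" "\<not> sat N \<phi> (a m) b2"
    using sat_iff_sat_later[OF m(1) \<beta> \<phi> k(2)] sat_iff_sat_later[OF m(2) \<beta> \<phi> l(2)] k(4) l(4) by auto
  have "b1 \<in> tuples \<kappa> \<beta> (M m)" "b2 \<in> tuples \<kappa> \<beta> (M m)"
    using k(2) l(2) M_le[OF m(1)] M_le[OF m(2)] by (auto simp: tuples_def)
  then have "(\<phi>, b1) \<in> tp \<kappa> N \<alpha> (a m) (M m)" "(Neg \<phi>, b2) \<in> tp \<kappa> N \<alpha> (a m) (M m)"
    using sat_m \<beta> \<phi> by (auto simp: tp_def fms_over_def intro: qf_fms.intros)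
  moreover have "b1 \<in> tuples \<kappa> \<beta> UNIV" "b2 \<in> tuples \<kappa> \<beta> UNIV"
    using k(2) l(2) by (auto simp: tuples_def)
  ultimately have "splits \<kappa> N (tp \<kappa> N \<alpha> (a m) (M m)) A"
    unfolding splits_def using \<beta> k(3) l(3) by metis
  moreover have "m \<in> Field I" using m by (auto simp: Field_def)
  ultimately show False using not_splits by blast
qed

end

section \<open>Completeness and consistency of the average types\<close>

theorem theorem5p21:
  fixes \<kappa> :: "'k rel" and N :: "('f, 'r, 'k, 'a) struct" and S :: "'a set set"
    and \<chi>0 :: "'c rel" and I :: "'i rel" and a :: "'i \<Rightarrow> ('k \<rightharpoonup> 'a)"
  assumes "Cinfinite \<kappa>"
    and "less_ary \<kappa> N"
    and "model_family \<kappa> N S"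
    and "Card_order \<chi>0"
    and "LS_card \<kappa> N \<le>o \<chi>0"
    and "\<not> order_property \<kappa> N (cardSuc \<chi>0)"
    and "Linear_order I"
    and "morley \<kappa> N S (cardSuc \<chi>0) (cardSuc \<chi>0) (cardSuc (ctwo ^c (ctwo ^c \<chi>0))) I a"
  shows "convergent \<kappa> N (cardSuc (ctwo ^c (ctwo ^c \<chi>0))) I a"
proof -
  let ?\<mu> = "ctwo ^c (ctwo ^c \<chi>0)"
  let ?\<chi> = "cardSuc ?\<mu>"
  have \<kappa>\<chi>0: "\<kappa> \<le>o \<chi>0"
    using LS_card_ge[of \<kappa> N] assms(1,5) ordLeq_transitive by blast
  have \<mu>: "Card_order ?\<mu>" by (rule Card_order_cexp)
  have \<chi>0\<mu>: "\<chi>0 \<le>o ctwo ^c \<chi>0" "ctwo ^c \<chi>0 \<le>o ?\<mu>"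
    using ordLess_ctwo_cexp[OF assms(4)] ordLess_ctwo_cexp[OF Card_order_cexp] ordLess_imp_ordLeq by blast+
  have \<kappa>\<mu>: "\<kappa> \<le>o ?\<mu>"
    by (rule ordLeq_transitive[OF \<kappa>\<chi>0 ordLeq_transitive[OF \<chi>0\<mu>]])
  have inf: "infinite (Field ?\<mu>)"
    using cinfinite_mono[OF \<kappa>\<mu>] assms(1) by (auto simp: cinfinite_def)
  have less_\<chi>: "|B| <o ?\<chi> \<longleftrightarrow> |B| \<le>o ?\<mu>" for B :: "'z set"
    using \<mu> by (simp add: cardSuc_ordLeq_ordLess card_of_Card_order)
  obtain \<alpha> p A M where \<alpha>: "\<alpha> \<in> Field \<kappa>"
    and M: "\<forall>i\<in>Field I. M i \<in> S \<and> a i \<in> tuples \<kappa> \<alpha> UNIV \<and> A \<subseteq> M i \<and>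
        saturated \<kappa> N (cardSuc \<chi>0) (M i) \<and> realizes N (a i) (restrict_fms p (M i)) \<and>
        \<not> splits \<kappa> N (tp \<kappa> N \<alpha> (a i) (M i)) A"
    and A: "|A| <o cardSuc \<chi>0"
    and incr: "\<forall>j\<in>Field I. \<forall>i\<in>underS I j. M i \<subseteq> M j \<and> a i \<in> tuples \<kappa> \<alpha> (M j) \<and> a i \<noteq> a j \<and>
        tp \<kappa> N \<alpha> (a i) (M i) = tp \<kappa> N \<alpha> (a j) (M i)"
    and size: "?\<chi> \<le>o |Field I|"
    using assms(8) unfolding morley_def morley_for_def by blast
  have underS_I: "j \<in> Field I" if "i \<in> underS I j" for i j
    using that by (auto simp: underS_def Field_def)
  interpret morley_setting \<kappa> N \<chi>0 \<alpha> I a M A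
    using assms(1,4,7) \<kappa>\<chi>0 \<alpha> M A incr underS_I
    by unfold_locales (auto simp: cardSuc_ordLeq_ordLess card_of_Card_order)
  have inj: "inj_on a (Field I)"
  proof
    fix i j assume ij: "i \<in> Field I" "j \<in> Field I" "a i = a j"
    then have "i = j \<or> i \<in> underS I j \<or> j \<in> underS I i"
      using I by (auto simp: linear_order_on_def total_on_def underS_def)
    then show "i = j" using incr ij by metis
  qed
  have "|Field I| \<le>o |a ` Field I|"
    using inj by (intro card_of_ordLeqI[of a]) auto
  then have size': "?\<chi> \<le>o |a ` Field I|"
    using size ordLeq_transitive by blast
  have WO: "Well_order (ctwo ^c \<chi>0)"
    using Card_order_cexp card_order_on_well_order_on by blast
  \<comment> \<open>By \<open>few_exceptions\<close>, \<phi> or its negation has at most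
    \<open>ctwo ^c \<chi>0\<close> exceptional indices, which is well below the threshold of the
    average.\<close>
  have decides: "(\<phi>, b) \<in> Av \<kappa> N ?\<chi> \<alpha> I a B \<or> (Neg \<phi>, b) \<in> Av \<kappa> N ?\<chi> \<alpha> I a B"
    if \<phi>b: "(\<phi>, b) \<in> fms_over \<kappa> N \<alpha> B" for \<phi> b B
  proof -
    obtain \<beta> where \<beta>: "\<beta> \<in> Field \<kappa>" "\<phi> \<in> qf_fms \<kappa> N (vars \<kappa> \<alpha> \<beta>)" "b \<in> tuples \<kappa> \<beta> B"
      using \<phi>b by (auto simp: fms_over_def)
    have Neg\<phi>: "(Neg \<phi>, b) \<in> fms_over \<kappa> N \<alpha> B"
      using \<beta> by (auto simp: fms_over_def intro: qf_fms.intros)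
    have small: "|{c \<in> a ` Field I. T c}| <o ?\<chi>" if "\<not> ctwo ^c \<chi>0 <o |{i \<in> Field I. T (a i)}|" for T
    proof -
      have "|{i \<in> Field I. T (a i)}| \<le>o ctwo ^c \<chi>0"
        using that not_ordLess_iff_ordLeq[OF card_of_Well_order WO] by blast
      then have "|{i \<in> Field I. T (a i)}| \<le>o ?\<mu>"
        by (rule ordLeq_transitive[OF _ \<chi>0\<mu>(2)])
      then have "|a ` {i \<in> Field I. T (a i)}| \<le>o ?\<mu>"
        by (rule ordLeq_transitive[OF card_of_image])
      moreover have "{c \<in> a ` Field I. T c} = a ` {i \<in> Field I. T (a i)}" by blast
      ultimately have "|{c \<in> a ` Field I. T c}| \<le>o ?\<mu>" by simp
      then show ?thesis by (simp add: less_\<chi>)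
    qed
    have "b \<in> tuples \<kappa> \<beta> UNIV" using \<beta>(3) by (simp add: tuples_def)
    from few_exceptions[OF assms(6) \<beta>(1,2) this] show ?thesis
      using small[of "\<lambda>c. sat N \<phi> c b"] small[of "\<lambda>c. \<not> sat N \<phi> c b"] \<phi>b Neg\<phi>
      by (auto simp: Av_def)
  qed
  \<comment> \<open>Fewer than \<open>\<kappa>\<close> sets of exceptions, each of size at most
    \<open>?\<mu>\<close>, cannot cover the at least \<open>?\<mu>\<^sup>+\<close> entries. A member
    of the sequence outside all of them realizes \<open>q\<close>.\<close>
  have consistent: "\<exists>c\<in>tuples \<kappa> \<alpha> UNIV. realizes N c q"
    if q: "q \<subseteq> Av \<kappa> N ?\<chi> \<alpha> I a B" "|q| <o \<kappa>" for q B
  proof -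
    let ?E = "\<lambda>\<phi>b. {c \<in> a ` Field I. \<not> sat N (fst \<phi>b) c (snd \<phi>b)}"
    have "|?E \<phi>b| \<le>o ?\<mu>" if "\<phi>b \<in> q" for \<phi>b
      using q(1) that by (auto simp: Av_def less_\<chi> split: prod.splits)
    moreover have "|q| \<le>o ?\<mu>"
      by (rule ordLess_imp_ordLeq[OF ordLess_ordLeq_trans[OF q(2) \<kappa>\<mu>]])
    ultimately have "|\<Union>\<phi>b\<in>q. ?E \<phi>b| \<le>o ?\<mu>"
      using inf \<mu> by (intro card_of_UNION_ordLeq_infinite_Field) auto
    then have "|\<Union>\<phi>b\<in>q. ?E \<phi>b| <o |a ` Field I|"
      using size' by (simp add: less_\<chi>[symmetric] ordLess_ordLeq_trans)
    then have "\<not> a ` Field I \<subseteq> (\<Union>\<phi>b\<in>q. ?E \<phi>b)"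
      using card_of_mono1 not_ordLess_ordLeq by blast
    then obtain i where "i \<in> Field I" "\<forall>\<phi>b\<in>q. sat N (fst \<phi>b) (a i) (snd \<phi>b)"
      by blast
    then show ?thesis
      using M by (intro bexI[of _ "a i"]) (auto simp: realizes_def)
  qed
  have "complete_type \<kappa> N \<alpha> B (Av \<kappa> N ?\<chi> \<alpha> I a B)" for B
    unfolding complete_type_def using decides consistent
    by (auto simp: Av_def)
  moreover have "a ` Field I \<subseteq> tuples \<kappa> \<alpha> UNIV"
    using M by blast
  ultimately show ?thesis
    unfolding convergent_def using \<alpha> size' by blast
qed

end
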